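(* For every $f\in L^2(\Omega)$ there exists a unique $(y,z)\in X=V\times U$ such that $\mathcal A((y,z),(v,u))=(f,u)$ for all $(v,u)\in X$, and there is a constant $C>0$, independent of $f$, such that $$\|y\|_V+\|z\|_U\le C\|f\|.$$
   Context: $\Omega\subset\mathbb R^d$, $d\in\{2,3\}$, is an open bounded convex domain with polygonal (polyhedral) boundary; $\kappa>0$ is a constant; $(\cdot,\cdot)$ and $\|\cdot\|$ are the $L^2(\Omega)$ inner product and norm. $V:=H_0^1(\Omega)\cap H^2(\Omega)$ with $\|v\|_V:=|v|_{H^2(\Omega)}=\|\nabla^2v\|$, and $U:=H_0^1(\Omega)$ with $\|u\|_U:=|u|_{H^1(\Omega)}$. $X:=V\times U$. The bilinear form is $\mathcal A((y,z),(v,u)):=(\nabla^2y,\nabla^2v)-(z,v)+(y,u)+(\kappa\nabla z,\nabla u)$. (This is the mixed weak form of $y-\mathrm{div}(\kappa\nabla\Delta^2y)=f$ with $z=\Delta^2y$ and boundary conditions $y=\Delta y=\Delta^2y=0$ on $\partial\Omega$.) *)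

theory Defs
  imports "HOL-Analysis.Analysis"
begin

text \<open>Functions on \<open>\<Omega>\<close> are total functions on the ambient space whose values outside \<open>\<Omega>\<close> are
  irrelevant: all spaces, integrals and norms are taken with respect to \<open>lebesgue_on \<Omega>\<close>. Elements
  of \<open>L\<^sup>2\<close> and of Sobolev spaces are represented by functions, not by equivalence classes, so
  equality of elements is equality almost everywhere on \<open>\<Omega>\<close>.\<close>

definition L2_space :: "(real^'n) set \<Rightarrow> (real^'n \<Rightarrow> real) set" where
  "L2_space \<Omega> = {f. f \<in> borel_measurable (lebesgue_on \<Omega>) \<and> integrable (lebesgue_on \<Omega>) (\<lambda>x. (f x)\<^sup>2)}"

definition L2_inner :: "(real^'n) set \<Rightarrow> (real^'n \<Rightarrow> real) \<Rightarrow> (real^'n \<Rightarrow> real) \<Rightarrow> real" where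
  "L2_inner \<Omega> f g = (LINT x|lebesgue_on \<Omega>. f x * g x)"

definition L2_norm :: "(real^'n) set \<Rightarrow> (real^'n \<Rightarrow> real) \<Rightarrow> real" where
  "L2_norm \<Omega> f = sqrt (L2_inner \<Omega> f f)"

definition locally_integrable :: "(real^'n) set \<Rightarrow> (real^'n \<Rightarrow> real) \<Rightarrow> bool" where
  "locally_integrable \<Omega> f \<longleftrightarrow> (\<forall>K. compact K \<and> K \<subseteq> \<Omega> \<longrightarrow> set_integrable lebesgue K f)"

definition partial_deriv :: "'n \<Rightarrow> (real^'n \<Rightarrow> real) \<Rightarrow> real^'n \<Rightarrow> real" where
  "partial_deriv i f x = frechet_derivative f (at x) (axis i 1)"

primrec C_diff :: "nat \<Rightarrow> (real^'n \<Rightarrow> real) \<Rightarrow> bool" where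
  "C_diff 0 f \<longleftrightarrow> continuous_on UNIV f"
| "C_diff (Suc k) f \<longleftrightarrow> (\<forall>x. f differentiable (at x)) \<and> (\<forall>i. C_diff k (partial_deriv i f))"

definition test_functions :: "(real^'n) set \<Rightarrow> (real^'n \<Rightarrow> real) set" where
  "test_functions \<Omega> =
     {\<phi>. (\<forall>k. C_diff k \<phi>) \<and> compact (closure {x. \<phi> x \<noteq> 0}) \<and> closure {x. \<phi> x \<noteq> 0} \<subseteq> \<Omega>}"

definition has_weak_partial ::
    "(real^'n) set \<Rightarrow> 'n \<Rightarrow> (real^'n \<Rightarrow> real) \<Rightarrow> (real^'n \<Rightarrow> real) \<Rightarrow> bool" where
  "has_weak_partial \<Omega> i f g \<longleftrightarrow>
     locally_integrable \<Omega> f \<and> locally_integrable \<Omega> g \<and>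
     (\<forall>\<phi>\<in>test_functions \<Omega>. (LINT x|lebesgue_on \<Omega>. f x * partial_deriv i \<phi> x)
                             = - (LINT x|lebesgue_on \<Omega>. g x * \<phi> x))"

text \<open>A weak derivative is unique up to a null set of \<open>\<Omega>\<close>; the choice below picks a representative.\<close>

definition weak_partial :: "(real^'n) set \<Rightarrow> 'n \<Rightarrow> (real^'n \<Rightarrow> real) \<Rightarrow> real^'n \<Rightarrow> real" where
  "weak_partial \<Omega> i f = (SOME g. has_weak_partial \<Omega> i f g)"

text \<open>\<open>H\<^sup>k(\<Omega>)\<close>: all weak derivatives of order at most \<open>k\<close> exist and lie in \<open>L\<^sup>2(\<Omega>)\<close>.\<close>

primrec sobolev_H :: "nat \<Rightarrow> (real^'n) set \<Rightarrow> (real^'n \<Rightarrow> real) set" where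
  "sobolev_H 0 \<Omega> = L2_space \<Omega>"
| "sobolev_H (Suc k) \<Omega> =
     {f \<in> L2_space \<Omega>. \<forall>i. \<exists>g\<in>sobolev_H k \<Omega>. has_weak_partial \<Omega> i f g}"

definition grad_inner :: "(real^'n) set \<Rightarrow> (real^'n \<Rightarrow> real) \<Rightarrow> (real^'n \<Rightarrow> real) \<Rightarrow> real" where
  "grad_inner \<Omega> u v = (\<Sum>i\<in>UNIV. L2_inner \<Omega> (weak_partial \<Omega> i u) (weak_partial \<Omega> i v))"

definition hess_inner :: "(real^'n) set \<Rightarrow> (real^'n \<Rightarrow> real) \<Rightarrow> (real^'n \<Rightarrow> real) \<Rightarrow> real" where
  "hess_inner \<Omega> u v = (\<Sum>i\<in>UNIV. \<Sum>j\<in>UNIV.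
     L2_inner \<Omega> (weak_partial \<Omega> i (weak_partial \<Omega> j u)) (weak_partial \<Omega> i (weak_partial \<Omega> j v)))"

definition H1_seminorm :: "(real^'n) set \<Rightarrow> (real^'n \<Rightarrow> real) \<Rightarrow> real" where
  "H1_seminorm \<Omega> u = sqrt (grad_inner \<Omega> u u)"

definition H2_seminorm :: "(real^'n) set \<Rightarrow> (real^'n \<Rightarrow> real) \<Rightarrow> real" where
  "H2_seminorm \<Omega> u = sqrt (hess_inner \<Omega> u u)"

definition H1_norm :: "(real^'n) set \<Rightarrow> (real^'n \<Rightarrow> real) \<Rightarrow> real" where
  "H1_norm \<Omega> u = sqrt ((L2_norm \<Omega> u)\<^sup>2 + (H1_seminorm \<Omega> u)\<^sup>2)"

text \<open>The closure of the test functions in \<open>H\<^sup>1(\<Omega>)\<close>.\<close>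

definition H10 :: "(real^'n) set \<Rightarrow> (real^'n \<Rightarrow> real) set" where
  "H10 \<Omega> = {u \<in> sobolev_H 1 \<Omega>.
     \<forall>\<epsilon>>0. \<exists>\<phi>\<in>test_functions \<Omega>. H1_norm \<Omega> (\<lambda>x. u x - \<phi> x) < \<epsilon>}"

definition V_space :: "(real^'n) set \<Rightarrow> (real^'n \<Rightarrow> real) set" where
  "V_space \<Omega> = H10 \<Omega> \<inter> sobolev_H 2 \<Omega>"

definition U_space :: "(real^'n) set \<Rightarrow> (real^'n \<Rightarrow> real) set" where
  "U_space \<Omega> = H10 \<Omega>"

definition X_space :: "(real^'n) set \<Rightarrow> ((real^'n \<Rightarrow> real) \<times> (real^'n \<Rightarrow> real)) set" where
  "X_space \<Omega> = V_space \<Omega> \<times> U_space \<Omega>"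

definition V_norm :: "(real^'n) set \<Rightarrow> (real^'n \<Rightarrow> real) \<Rightarrow> real" where
  "V_norm \<Omega> v = H2_seminorm \<Omega> v"

definition U_norm :: "(real^'n) set \<Rightarrow> (real^'n \<Rightarrow> real) \<Rightarrow> real" where
  "U_norm \<Omega> u = H1_seminorm \<Omega> u"

fun A_form :: "(real^'n) set \<Rightarrow> real \<Rightarrow> (real^'n \<Rightarrow> real) \<times> (real^'n \<Rightarrow> real)
    \<Rightarrow> (real^'n \<Rightarrow> real) \<times> (real^'n \<Rightarrow> real) \<Rightarrow> real" where
  "A_form \<Omega> \<kappa> (y, z) (v, u) =
     hess_inner \<Omega> y v - L2_inner \<Omega> z v + L2_inner \<Omega> y u + \<kappa> * grad_inner \<Omega> z u"

definition weak_solution :: "(real^'n) set \<Rightarrow> real \<Rightarrow> (real^'n \<Rightarrow> real)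
    \<Rightarrow> (real^'n \<Rightarrow> real) \<Rightarrow> (real^'n \<Rightarrow> real) \<Rightarrow> bool" where
  "weak_solution \<Omega> \<kappa> f y z \<longleftrightarrow> (y, z) \<in> X_space \<Omega> \<and>
     (\<forall>(v, u)\<in>X_space \<Omega>. A_form \<Omega> \<kappa> (y, z) (v, u) = L2_inner \<Omega> f u)"

end

theory Submission
  imports Defs
begin

text \<open>The bilinear form is coercive: in \<open>A ((y, z), (y, z))\<close> the two coupling terms cancel, and what remains is
\<open>\<parallel>\<nabla>\<^sup>2y\<parallel>\<^sup>2 + \<kappa> \<parallel>\<nabla>z\<parallel>\<^sup>2\<close>. Stability follows from this identity and the Poincare inequality
(\<open>weak_solution_stability\<close>), and uniqueness is stability for the data \<open>f = 0\<close>
(\<open>weak_solution_unique\<close>), provided that \<open>\<parallel>\<nabla>\<^sup>2v\<parallel>\<close> controls \<open>\<parallel>v\<parallel>\<close> on \<open>V\<close>. The latter comes from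
\<open>\<parallel>\<nabla>v\<parallel>\<^sup>2 = - (v, \<Delta>v)\<close>, where approximation of \<open>v\<close> by test functions replaces any boundary integral
(\<open>Green_formula\<close>, \<open>H1_seminorm_le_H2_seminorm\<close>).

For existence the nonsymmetric system is condensed to a symmetric problem. The second equation is
solved for \<open>z = T (f - y)\<close>, where \<open>T\<close> inverts
\<open>- div (\<kappa> \<nabla>\<cdot>)\<close>; since \<open>T\<close> is symmetric and nonnegative, the remaining equation for \<open>y\<close> is symmetric
and coercive on \<open>V\<close>. Both problems are then instances of the Riesz representation theorem
(\<open>Riesz_representation\<close>, \<open>weak_solution_exists\<close>), which is proved by minimisation in a complete set
of functions with a semi-inner product.

The analytic input is the completeness of \<open>H10\<close> in the gradient seminorm and of \<open>V\<close> in the Hessian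
seminorm. It rests on the completeness of \<open>L\<^sup>2\<close> (\<open>L2_complete\<close>), on the closedness of weak derivatives
(\<open>has_weak_partial_limit\<close>) and on the Poincare inequality (\<open>Poincare_inequality\<close>). As weak
derivatives are selected representatives, linearity of every form depends on their uniqueness almost
everywhere, that is, on the fundamental lemma of the calculus of variations, for which smooth bump
functions supported in boxes are constructed.\<close>

section \<open>Functions with a semi-inner product\<close>

text \<open>The first-order condition at the minimum of a quadratic functional: a nonzero linear coefficient
would win against \<open>c\<^sup>2 a\<close> for small \<open>c\<close> of the right sign.\<close>

lemma quadratic_nonneg_imp_linear_coeff_zero:
  fixes a b :: real
  assumes "\<And>c. 0 \<le> c\<^sup>2 * a + 2 * c * b"
  shows "b = 0"
proof (rule ccontr)
  assume b: "b \<noteq> 0"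
  have a: "a > 0"
  proof (rule ccontr)
    assume "\<not> a > 0"
    have "2 * b\<^sup>2 \<le> b\<^sup>2 * a" using assms[of "-b"] by (simp add: power2_eq_square)
    moreover have "b\<^sup>2 * a \<le> 0" using \<open>\<not> a > 0\<close> by (simp add: mult_nonneg_nonpos)
    ultimately show False using zero_less_power2[of b] b by linarith
  qed
  have "(-b/a)\<^sup>2 * a + 2 * (-b/a) * b = - b\<^sup>2 / a"
    using a by (simp add: field_simps power2_eq_square)
  moreover have "- b\<^sup>2 / a < 0" using a b by simp
  ultimately show False using assms[of "-b/a"] by linarith
qed

text \<open>The carrier is a set of functions rather than a type, since the spaces in question depend on the
domain \<open>\<Omega>\<close>, and the form is only positive semidefinite, since functions that agree almost
everywhere are not identified. Limits in the seminorm are therefore not unique.\<close>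

locale semi_inner_space =
  fixes S :: "('a \<Rightarrow> real) set" and B :: "('a \<Rightarrow> real) \<Rightarrow> ('a \<Rightarrow> real) \<Rightarrow> real"
  assumes zero_mem: "(\<lambda>x. 0) \<in> S"
    and lin_mem: "u \<in> S \<Longrightarrow> v \<in> S \<Longrightarrow> (\<lambda>x. u x + c * v x) \<in> S"
    and sym: "u \<in> S \<Longrightarrow> v \<in> S \<Longrightarrow> B u v = B v u"
    and lin: "u \<in> S \<Longrightarrow> v \<in> S \<Longrightarrow> w \<in> S \<Longrightarrow> B (\<lambda>x. u x + c * v x) w = B u w + c * B v w"
    and nonneg: "u \<in> S \<Longrightarrow> 0 \<le> B u u"
begin

definition seminorm :: "('a \<Rightarrow> real) \<Rightarrow> real" where
  "seminorm u = sqrt (B u u)"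

definition complete :: bool where
  "complete \<longleftrightarrow> (\<forall>s. (\<forall>n. s n \<in> S) \<longrightarrow>
     (\<forall>e>0. \<exists>M. \<forall>m\<ge>M. \<forall>n\<ge>M. seminorm (\<lambda>x. s m x - s n x) < e) \<longrightarrow>
     (\<exists>u\<in>S. (\<lambda>n. seminorm (\<lambda>x. s n x - u x)) \<longlonglongrightarrow> 0))"

lemma complete_limit:
  assumes complete "\<And>n. s n \<in> S"
    and "\<forall>e>0. \<exists>M. \<forall>m\<ge>M. \<forall>n\<ge>M. seminorm (\<lambda>x. s m x - s n x) < e"
  obtains u where "u \<in> S" "(\<lambda>n. seminorm (\<lambda>x. s n x - u x)) \<longlonglongrightarrow> 0"
proof -
  have "\<exists>u\<in>S. (\<lambda>n. seminorm (\<lambda>x. s n x - u x)) \<longlonglongrightarrow> 0"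
    by (rule assms(1)[unfolded complete_def, THEN spec, THEN mp, THEN mp]) (use assms(2,3) in simp_all)
  then show ?thesis using that by blast
qed

lemma scale_mem: "v \<in> S \<Longrightarrow> (\<lambda>x. c * v x) \<in> S"
  using lin_mem[OF zero_mem, of v c] by simp

lemma diff_mem: "u \<in> S \<Longrightarrow> v \<in> S \<Longrightarrow> (\<lambda>x. u x - v x) \<in> S"
  using lin_mem[of u v "-1"] by simp

lemma lin_right:
  "u \<in> S \<Longrightarrow> v \<in> S \<Longrightarrow> w \<in> S \<Longrightarrow> B w (\<lambda>x. u x + c * v x) = B w u + c * B w v"
  by (simp add: sym[of w] lin lin_mem)

lemma diff_left: "u \<in> S \<Longrightarrow> v \<in> S \<Longrightarrow> w \<in> S \<Longrightarrow> B (\<lambda>x. u x - v x) w = B u w - B v w"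
  using lin[of u v w "-1"] by simp

lemma seminorm_nonneg: "u \<in> S \<Longrightarrow> 0 \<le> seminorm u"
  by (simp add: seminorm_def nonneg)

lemma seminorm_power2: "u \<in> S \<Longrightarrow> (seminorm u)\<^sup>2 = B u u"
  by (simp add: seminorm_def nonneg)

lemma B_lin_lin:
  assumes "u \<in> S" "v \<in> S"
  shows "B (\<lambda>x. u x + c * v x) (\<lambda>x. u x + c * v x) = B u u + 2 * c * B u v + c\<^sup>2 * B v v"
  using assms by (simp add: lin lin_right lin_mem sym[of v u] algebra_simps power2_eq_square)

lemma Cauchy_Schwarz:
  assumes "u \<in> S" "v \<in> S"
  shows "\<bar>B u v\<bar> \<le> seminorm u * seminorm v"
proof -
  have q: "0 \<le> B u u + 2 * c * B u v + c\<^sup>2 * B v v" for c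
    using nonneg[OF lin_mem[OF assms, of c]] B_lin_lin[OF assms] by simp
  have "(B u v)\<^sup>2 \<le> B u u * B v v"
  proof (cases "B v v = 0")
    case True
    have "B u v = 0"
    proof (rule ccontr)
      assume b: "B u v \<noteq> 0"
      show False using q[of "- (B u u + 1) / (2 * B u v)"] True b by (simp add: field_simps)
    qed
    then show ?thesis using True by simp
  next
    case False
    then have p: "B v v > 0" using nonneg[OF assms(2)] by simp
    have "B u u + 2 * (- B u v / B v v) * B u v + (- B u v / B v v)\<^sup>2 * B v v
        = B u u - (B u v)\<^sup>2 / B v v"
      using p by (simp add: field_simps power2_eq_square)
    then have "(B u v)\<^sup>2 / B v v \<le> B u u" using q[of "- B u v / B v v"] by linarith
    then show ?thesis using p by (simp add: field_simps)
  qed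
  then have "(B u v)\<^sup>2 \<le> (seminorm u * seminorm v)\<^sup>2"
    by (simp add: power_mult_distrib seminorm_power2 assms)
  then show ?thesis
    using seminorm_nonneg assms by (simp add: abs_le_square_iff[symmetric])
qed

lemma seminorm_scale: "v \<in> S \<Longrightarrow> seminorm (\<lambda>x. c * v x) = \<bar>c\<bar> * seminorm v"
proof -
  assume v: "v \<in> S"
  have "B (\<lambda>x. c * v x) (\<lambda>x. c * v x) = c\<^sup>2 * B v v"
    using lin[OF zero_mem v, of "\<lambda>x. c * v x" c] lin_right[OF zero_mem v v, of c]
      lin[OF zero_mem zero_mem, of _ 1]  lin_right[OF zero_mem zero_mem, of _ 1] v
    by (simp add: scale_mem power2_eq_square zero_mem)
  then show ?thesis by (simp add: seminorm_def real_sqrt_mult)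
qed

lemma seminorm_triangle:
  assumes "u \<in> S" "v \<in> S"
  shows "seminorm (\<lambda>x. u x + c * v x) \<le> seminorm u + \<bar>c\<bar> * seminorm v"
proof (rule power2_le_imp_le)
  have "(seminorm (\<lambda>x. u x + c * v x))\<^sup>2 = B u u + 2 * c * B u v + c\<^sup>2 * B v v"
    by (simp add: seminorm_power2 lin_mem assms B_lin_lin)
  also have "\<dots> \<le> (seminorm u)\<^sup>2 + 2 * \<bar>c\<bar> * (seminorm u * seminorm v) + \<bar>c\<bar>\<^sup>2 * (seminorm v)\<^sup>2"
  proof -
    have "c * B u v \<le> \<bar>c\<bar> * (seminorm u * seminorm v)"
      using mult_left_mono[OF Cauchy_Schwarz[OF assms], of "\<bar>c\<bar>"] abs_ge_self[of "c * B u v"]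
      by (simp add: abs_mult)
    then show ?thesis by (simp add: seminorm_power2 assms)
  qed
  also have "\<dots> = (seminorm u + \<bar>c\<bar> * seminorm v)\<^sup>2" by (simp add: power2_eq_square algebra_simps)
  finally show "(seminorm (\<lambda>x. u x + c * v x))\<^sup>2 \<le> (seminorm u + \<bar>c\<bar> * seminorm v)\<^sup>2" .
  show "0 \<le> seminorm u + \<bar>c\<bar> * seminorm v" using seminorm_nonneg assms by simp
qed

lemma seminorm_diff_commute: "u \<in> S \<Longrightarrow> v \<in> S \<Longrightarrow> seminorm (\<lambda>x. u x - v x) = seminorm (\<lambda>x. v x - u x)"
  using seminorm_scale[OF diff_mem, of u v "-1"] by simp

lemma seminorm_diff_triangle:
  assumes "u \<in> S" "v \<in> S" "w \<in> S"
  shows "seminorm (\<lambda>x. u x - w x) \<le> seminorm (\<lambda>x. u x - v x) + seminorm (\<lambda>x. v x - w x)"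
  using seminorm_triangle[OF diff_mem[OF assms(1,2)] diff_mem[OF assms(2,3)], of 1] by simp

lemma seminorm_le_add_diff:
  assumes "u \<in> S" "v \<in> S"
  shows "seminorm u \<le> seminorm v + seminorm (\<lambda>x. u x - v x)"
  using seminorm_triangle[OF assms(2) diff_mem[OF assms], of 1] by simp

lemma tendsto_B_left:
  assumes "\<And>n. s n \<in> S" "u \<in> S" "(\<lambda>n. seminorm (\<lambda>x. s n x - u x)) \<longlonglongrightarrow> 0" "v \<in> S"
  shows "(\<lambda>n. B (s n) v) \<longlonglongrightarrow> B u v"
proof -
  have "(\<lambda>n. seminorm (\<lambda>x. s n x - u x) * seminorm v) \<longlonglongrightarrow> 0"
    using tendsto_mult_right[OF assms(3), of "seminorm v"] by simp
  then have "(\<lambda>n. B (s n) v - B u v) \<longlonglongrightarrow> 0"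
  proof (rule Lim_null_comparison[rotated], intro always_eventually allI)
    fix n
    show "norm (B (s n) v - B u v) \<le> seminorm (\<lambda>x. s n x - u x) * seminorm v"
      using Cauchy_Schwarz[OF diff_mem[OF assms(1)[of n] assms(2)] assms(4)]
      by (simp add: diff_left assms)
  qed
  then show ?thesis by (simp add: LIM_zero_iff)
qed

text \<open>The representing element minimises \<open>J u = B u u - 2 * l u\<close>. Boundedness of \<open>l\<close> bounds \<open>J\<close> from below;
the parallelogram identity, applied to the midpoint of two members of a minimising sequence, shows
that the sequence is Cauchy; its limit attains the infimum, and the first variation of \<open>J\<close> there is
\<open>B u v - l v\<close>.\<close>

theorem Riesz_representation:
  assumes complete
    and l_lin: "\<And>u v c. u \<in> S \<Longrightarrow> v \<in> S \<Longrightarrow> l (\<lambda>x. u x + c * v x) = l u + c * l v"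
    and l_bound: "\<And>u. u \<in> S \<Longrightarrow> \<bar>l u\<bar> \<le> C * seminorm u"
  obtains u where "u \<in> S" "\<And>v. v \<in> S \<Longrightarrow> B u v = l v"
proof -
  define J where "J u = B u u - 2 * l u" for u
  define m where "m = Inf (J ` S)"
  have J_lower: "- C\<^sup>2 \<le> J u" if "u \<in> S" for u
  proof -
    have "0 \<le> (seminorm u - C)\<^sup>2" by simp
    also have "\<dots> = B u u - 2 * (C * seminorm u) + C\<^sup>2"
      by (simp add: power2_diff seminorm_power2 that algebra_simps)
    also have "\<dots> \<le> J u + C\<^sup>2" using l_bound[OF that] by (simp add: J_def)
    finally show ?thesis by simp
  qed
  have bdd: "bdd_below (J ` S)" using J_lower by (rule bdd_belowI2)
  have m_le: "m \<le> J u" if "u \<in> S" for u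
    unfolding m_def using that bdd by (simp add: cInf_lower)
  have "\<exists>u\<in>S. J u < m + 1 / real (Suc n)" for n
  proof -
    have "Inf (J ` S) < m + 1 / real (Suc n)" by (simp add: m_def)
    then show ?thesis using cInf_lessD[of "J ` S"] zero_mem by blast
  qed
  then obtain s where s: "\<And>n. s n \<in> S" "\<And>n. J (s n) < m + 1 / real (Suc n)"
    by metis
  have J_lin: "J (\<lambda>x. u x + c * v x) = J u + 2 * c * (B u v - l v) + c\<^sup>2 * B v v"
    if "u \<in> S" "v \<in> S" for u v c
    using that by (simp add: J_def B_lin_lin l_lin algebra_simps)
  have parallelogram: "B (\<lambda>x. s i x - s j x) (\<lambda>x. s i x - s j x) \<le> 2 / real (Suc i) + 2 / real (Suc j)"
    for i j
  proof -
    let ?d = "\<lambda>x. s i x - s j x"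
    have d: "?d \<in> S" by (rule diff_mem[OF s(1) s(1)])
    have mid: "(\<lambda>x. s j x + 1/2 * ?d x) \<in> S" by (rule lin_mem[OF s(1) d])
    have 1: "J (s i) = J (s j) + 2 * (B (s j) ?d - l ?d) + B ?d ?d"
      using J_lin[OF s(1)[of j] d, of 1] by simp
    have 2: "J (\<lambda>x. s j x + 1/2 * ?d x) = J (s j) + (B (s j) ?d - l ?d) + B ?d ?d / 4"
      using J_lin[OF s(1)[of j] d, of "1/2"] by (simp add: power2_eq_square)
    have "B ?d ?d = 2 * J (s i) + 2 * J (s j) - 4 * J (\<lambda>x. s j x + 1/2 * ?d x)"
      unfolding 1 2 by simp
    also have "\<dots> \<le> 2 * (m + 1 / real (Suc i)) + 2 * (m + 1 / real (Suc j)) - 4 * m"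
    proof -
      have "2 * a + 2 * b - 4 * c \<le> 2 * (m + p) + 2 * (m + q) - 4 * m"
        if "a < m + p" "b < m + q" "m \<le> c" for a b c p q :: real
        using that by (simp add: algebra_simps)
      from this[OF s(2) s(2) m_le[OF mid]] show ?thesis .
    qed
    finally show ?thesis by (simp add: algebra_simps)
  qed
  have "\<forall>e>0. \<exists>M. \<forall>i\<ge>M. \<forall>j\<ge>M. seminorm (\<lambda>x. s i x - s j x) < e"
  proof (intro allI impI)
    fix e :: real assume e: "e > 0"
    obtain M where M: "1 / real (Suc M) < e\<^sup>2 / 4"
      using nat_approx_posE[of "e\<^sup>2/4"] e by auto
    have "seminorm (\<lambda>x. s i x - s j x) < e" if "i \<ge> M" "j \<ge> M" for i j
    proof (rule power2_less_imp_less)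
      have "2 / real (Suc i) \<le> 2 / real (Suc M)" "2 / real (Suc j) \<le> 2 / real (Suc M)"
        using that by (auto intro!: divide_left_mono)
      then show "(seminorm (\<lambda>x. s i x - s j x))\<^sup>2 < e\<^sup>2"
        using parallelogram[of i j] M by (simp add: seminorm_power2 diff_mem s)
    qed (use e in simp)
    then show "\<exists>M. \<forall>i\<ge>M. \<forall>j\<ge>M. seminorm (\<lambda>x. s i x - s j x) < e" by blast
  qed
  then obtain u where u: "u \<in> S" "(\<lambda>n. seminorm (\<lambda>x. s n x - u x)) \<longlonglongrightarrow> 0"
    using \<open>complete\<close> s(1) unfolding complete_def by blast
  have "J u \<le> m"
  proof (rule LIMSEQ_le[rotated 2])
    define d where "d n = seminorm (\<lambda>x. s n x - u x)" for n
    have "(\<lambda>n. m + 1 / real (Suc n) + 2 * (seminorm u + C) * d n) \<longlonglongrightarrow> m + 0 + 2 * (seminorm u + C) * 0"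
      using u(2) LIMSEQ_Suc[OF lim_inverse_n'] unfolding d_def by (intro tendsto_intros) auto
    then show "(\<lambda>n. m + 1 / real (Suc n) + 2 * (seminorm u + C) * d n) \<longlonglongrightarrow> m" by simp
    show "(\<lambda>n. J u) \<longlonglongrightarrow> J u" by simp
    have "J u \<le> m + 1 / real (Suc n) + 2 * (seminorm u + C) * d n" for n
    proof -
      let ?d = "\<lambda>x. s n x - u x"
      have D: "?d \<in> S" by (rule diff_mem[OF s(1) u(1)])
      have "J (s n) = J u + 2 * (B u ?d - l ?d) + B ?d ?d"
        using J_lin[OF u(1) D, of 1] by simp
      moreover have "\<bar>B u ?d\<bar> \<le> seminorm u * d n" "\<bar>l ?d\<bar> \<le> C * d n" "0 \<le> B ?d ?d"
        using Cauchy_Schwarz[OF u(1) D] l_bound[OF D] nonneg[OF D] by (simp_all add: d_def)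
      ultimately show ?thesis using s(2)[of n] by (simp add: algebra_simps)
    qed
    then show "\<exists>K. \<forall>n\<ge>K. J u \<le> m + 1 / real (Suc n) + 2 * (seminorm u + C) * d n" by blast
  qed
  have "B u v = l v" if v: "v \<in> S" for v
  proof -
    have "0 \<le> c\<^sup>2 * B v v + 2 * c * (B u v - l v)" for c
      using m_le[OF lin_mem[OF u(1) v, of c]] J_lin[OF u(1) v, of c] \<open>J u \<le> m\<close> by linarith
    then show ?thesis using quadratic_nonneg_imp_linear_coeff_zero by fastforce
  qed
  then show ?thesis using that u(1) by blast
qed

end

text \<open>Used to pass from the Hessian form on \<open>V\<close> to the form of the condensed problem.\<close>

lemma complete_equivalent:
  fixes S :: "('a \<Rightarrow> real) set"
  assumes "semi_inner_space S B" "semi_inner_space S B'" "semi_inner_space.complete S B"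
    and lower: "\<And>u. u \<in> S \<Longrightarrow> B u u \<le> B' u u"
    and upper: "\<And>u. u \<in> S \<Longrightarrow> B' u u \<le> K * B u u"
  shows "semi_inner_space.complete S B'"
proof -
  interpret B: semi_inner_space S B by fact
  interpret B': semi_inner_space S B' by fact
  show ?thesis
    unfolding B'.complete_def
  proof (intro allI impI)
    fix s :: "nat \<Rightarrow> 'a \<Rightarrow> real"
    assume "\<forall>n. s n \<in> S" and C: "\<forall>e>0. \<exists>M. \<forall>m\<ge>M. \<forall>n\<ge>M. B'.seminorm (\<lambda>x. s m x - s n x) < e"
    then have s: "\<And>n. s n \<in> S" by simp
    have "\<forall>e>0. \<exists>M. \<forall>m\<ge>M. \<forall>n\<ge>M. B.seminorm (\<lambda>x. s m x - s n x) < e"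
    proof (intro allI impI)
      fix e :: real assume "e > 0"
      from C[THEN spec, THEN mp, OF this]
      obtain M where M: "\<forall>m\<ge>M. \<forall>n\<ge>M. B'.seminorm (\<lambda>x. s m x - s n x) < e" by (rule exE)
      have "B.seminorm (\<lambda>x. s m x - s n x) < e" if "m \<ge> M" "n \<ge> M" for m n
      proof -
        have "B.seminorm (\<lambda>x. s m x - s n x) \<le> B'.seminorm (\<lambda>x. s m x - s n x)"
          unfolding B.seminorm_def B'.seminorm_def by (intro real_sqrt_le_mono lower B.diff_mem s)
        also have "\<dots> < e" using M that by simp
        finally show ?thesis .
      qed
      then show "\<exists>M. \<forall>m\<ge>M. \<forall>n\<ge>M. B.seminorm (\<lambda>x. s m x - s n x) < e"
        by (intro exI[of _ M] allI impI)
    qed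
    then obtain u where u: "u \<in> S" "(\<lambda>n. B.seminorm (\<lambda>x. s n x - u x)) \<longlonglongrightarrow> 0"
      by (rule B.complete_limit[OF assms(3) s])
    have le: "B'.seminorm (\<lambda>x. s n x - u x) \<le> sqrt K * B.seminorm (\<lambda>x. s n x - u x)" for n
      unfolding B.seminorm_def B'.seminorm_def real_sqrt_mult[symmetric]
      by (intro real_sqrt_le_mono upper B.diff_mem s u)
    have lim: "(\<lambda>n. sqrt K * B.seminorm (\<lambda>x. s n x - u x)) \<longlonglongrightarrow> 0"
      using tendsto_mult_left[OF u(2), of "sqrt K"] by simp
    have "(\<lambda>n. B'.seminorm (\<lambda>x. s n x - u x)) \<longlonglongrightarrow> 0"
      by (rule tendsto_sandwich[OF _ _ tendsto_const lim])
        (intro always_eventually allI B'.seminorm_nonneg B'.diff_mem s u, intro always_eventually allI le)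
    then show "\<exists>u\<in>S. (\<lambda>n. B'.seminorm (\<lambda>x. s n x - u x)) \<longlonglongrightarrow> 0" using u(1) by (rule bexI)
  qed
qed

section \<open>The space L2\<close>

lemma L2_mult_integrable:
  assumes "f \<in> L2_space \<Omega>" "g \<in> L2_space \<Omega>"
  shows "integrable (lebesgue_on \<Omega>) (\<lambda>x. f x * g x)"
proof (rule Bochner_Integration.integrable_bound)
  show "integrable (lebesgue_on \<Omega>) (\<lambda>x. (f x)\<^sup>2 + (g x)\<^sup>2)"
    using assms by (auto simp: L2_space_def)
  show "(\<lambda>x. f x * g x) \<in> borel_measurable (lebesgue_on \<Omega>)"
    using assms by (auto simp: L2_space_def)
  have "\<bar>a * b\<bar> \<le> a\<^sup>2 + b\<^sup>2" for a b :: real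
  proof -
    have "2 * \<bar>a * b\<bar> \<le> \<bar>a\<bar>\<^sup>2 + \<bar>b\<bar>\<^sup>2"
      using sum_squares_bound[of "\<bar>a\<bar>" "\<bar>b\<bar>"] by (simp add: abs_mult)
    then show ?thesis using abs_ge_zero[of "a*b"] by simp
  qed
  then show "AE x in lebesgue_on \<Omega>. norm (f x * g x) \<le> norm ((f x)\<^sup>2 + (g x)\<^sup>2)"
    by (simp add: abs_mult)
qed

lemma L2_cong_AE:
  assumes "f \<in> L2_space \<Omega>" "AE x in lebesgue_on \<Omega>. f x = g x" "g \<in> borel_measurable (lebesgue_on \<Omega>)"
  shows "g \<in> L2_space \<Omega>"
proof -
  have "AE x in lebesgue_on \<Omega>. (f x)\<^sup>2 = (g x)\<^sup>2" using assms(2) by auto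
  then have "integrable (lebesgue_on \<Omega>) (\<lambda>x. (g x)\<^sup>2)"
    using assms integrable_cong_AE[of "\<lambda>x. (f x)\<^sup>2" "lebesgue_on \<Omega>" "\<lambda>x. (g x)\<^sup>2"] by (auto simp: L2_space_def)
  then show ?thesis using assms by (auto simp: L2_space_def)
qed

lemma L2_inner_cong_AE:
  assumes "AE x in lebesgue_on \<Omega>. f x = f' x" "AE x in lebesgue_on \<Omega>. g x = g' x"
    and "f \<in> borel_measurable (lebesgue_on \<Omega>)" "f' \<in> borel_measurable (lebesgue_on \<Omega>)"
     "g \<in> borel_measurable (lebesgue_on \<Omega>)" "g' \<in> borel_measurable (lebesgue_on \<Omega>)"
  shows "L2_inner \<Omega> f g = L2_inner \<Omega> f' g'"
  unfolding L2_inner_def using assms by (intro integral_cong_AE) auto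

interpretation L2: semi_inner_space "L2_space \<Omega>" "L2_inner \<Omega>"
  rewrites "semi_inner_space.seminorm (L2_inner \<Omega>) = L2_norm \<Omega>"
  for \<Omega> :: "(real^'n) set"
proof -
  show *: "semi_inner_space (L2_space \<Omega>) (L2_inner \<Omega>)"
  proof
    show "(\<lambda>x. 0) \<in> L2_space \<Omega>" by (simp add: L2_space_def)
    fix u v w :: "real^'n \<Rightarrow> real" and c :: real
    assume u: "u \<in> L2_space \<Omega>"
    show "0 \<le> L2_inner \<Omega> u u" by (simp add: L2_inner_def)
    assume v: "v \<in> L2_space \<Omega>"
    show "L2_inner \<Omega> u v = L2_inner \<Omega> v u" by (simp add: L2_inner_def mult.commute)
    show "(\<lambda>x. u x + c * v x) \<in> L2_space \<Omega>"
    proof -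
      have "integrable (lebesgue_on \<Omega>) (\<lambda>x. (u x)\<^sup>2 + (2 * c) * (u x * v x) + c\<^sup>2 * (v x)\<^sup>2)"
        using u v L2_mult_integrable[OF u v]
        by (intro Bochner_Integration.integrable_add integrable_mult_right) (simp_all add: L2_space_def)
      moreover have "(\<lambda>x. (u x)\<^sup>2 + (2 * c) * (u x * v x) + c\<^sup>2 * (v x)\<^sup>2) = (\<lambda>x. (u x + c * v x)\<^sup>2)"
        by (rule ext) (simp add: power2_eq_square algebra_simps)
      ultimately show ?thesis
        using u v by (auto simp: L2_space_def)
    qed
    assume w: "w \<in> L2_space \<Omega>"
    show "L2_inner \<Omega> (\<lambda>x. u x + c * v x) w = L2_inner \<Omega> u w + c * L2_inner \<Omega> v w"
      using L2_mult_integrable[OF u w] L2_mult_integrable[OF v w]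
      by (simp add: L2_inner_def distrib_right mult.assoc)
  qed
  show "semi_inner_space.seminorm (L2_inner \<Omega>) = L2_norm \<Omega>"
    by (rule ext) (simp add: semi_inner_space.seminorm_def[OF *] L2_norm_def)
qed

lemma L2_norm_zero_imp_AE:
  assumes "f \<in> L2_space \<Omega>" "L2_norm \<Omega> f = 0"
  shows "AE x in lebesgue_on \<Omega>. f x = 0"
proof -
  have "(LINT x|lebesgue_on \<Omega>. (f x)\<^sup>2) = 0"
    using assms(2) by (simp add: L2_norm_def L2_inner_def power2_eq_square)
  then show ?thesis
    using integral_nonneg_eq_0_iff_AE[of "lebesgue_on \<Omega>" "\<lambda>x. (f x)\<^sup>2"] assms(1) by (simp add: L2_space_def)
qed

text \<open>On a set of finite measure an \<open>L\<^sup>2\<close> Cauchy sequence is also \<open>L\<^sup>1\<close> Cauchy, so a subsequence converges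
almost everywhere; Fatou's lemma along that subsequence bounds the \<open>L\<^sup>2\<close> distance to the pointwise
limit.\<close>

theorem L2_complete:
  fixes \<Omega> :: "(real^'n) set"
  assumes fin: "finite_measure (lebesgue_on \<Omega>)"
  shows "semi_inner_space.complete (L2_space \<Omega>) (L2_inner \<Omega>)"
  unfolding L2.complete_def
proof (intro allI impI)
  interpret finite_measure "lebesgue_on \<Omega>" by fact
  let ?M = "lebesgue_on \<Omega>"
  fix s :: "nat \<Rightarrow> real^'n \<Rightarrow> real"
  assume "\<forall>n. s n \<in> L2_space \<Omega>"
    and "\<forall>e>0. \<exists>M. \<forall>m\<ge>M. \<forall>n\<ge>M. L2_norm \<Omega> (\<lambda>x. s m x - s n x) < e"
  then have s: "\<And>n. s n \<in> L2_space \<Omega>"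
    and cauchy: "\<And>e. e > 0 \<Longrightarrow> \<exists>M. \<forall>m\<ge>M. \<forall>n\<ge>M. L2_norm \<Omega> (\<lambda>x. s m x - s n x) < e"
    by blast+
  have meas[measurable]: "s n \<in> borel_measurable ?M" for n
    using s[of n] by (simp add: L2_space_def)
  have one: "(\<lambda>x. 1) \<in> L2_space \<Omega>" by (simp add: L2_space_def)
  have abs_mem: "(\<lambda>x. \<bar>f x\<bar>) \<in> L2_space \<Omega>" if "f \<in> L2_space \<Omega>" for f
    using that by (auto simp: L2_space_def)
  have abs_norm: "L2_norm \<Omega> (\<lambda>x. \<bar>f x\<bar>) = L2_norm \<Omega> f" for f
    by (simp add: L2_norm_def L2_inner_def)
  have L1: "integrable ?M (s n)" for n
    using L2_mult_integrable[OF s[of n] one] by simp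
  \<comment> \<open>The summand 1 makes \<open>K\<close> positive even if \<open>\<Omega>\<close> is a null set.\<close>
  define K where "K = L2_norm \<Omega> (\<lambda>x. 1) + 1"
  have K: "K > 0" using L2.seminorm_nonneg[OF one] by (simp add: K_def)
  have L1_le: "(LINT x|?M. norm (f x)) \<le> K * L2_norm \<Omega> f" if f: "f \<in> L2_space \<Omega>" for f
  proof -
    have "(LINT x|?M. norm (f x)) \<le> L2_norm \<Omega> f * L2_norm \<Omega> (\<lambda>x. 1)"
      using L2.Cauchy_Schwarz[OF abs_mem[OF f] one] by (simp add: L2_inner_def[of _ _ "\<lambda>x. 1"] abs_norm)
    also have "\<dots> \<le> K * L2_norm \<Omega> f"
      using L2.seminorm_nonneg[OF f] by (simp add: K_def algebra_simps)
    finally show ?thesis .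
  qed
  have "\<exists>M. \<forall>i\<ge>M. \<forall>j\<ge>M. (LINT x|?M. norm (s i x - s j x)) < e" if e: "e > 0" for e
  proof -
    obtain M where M: "\<forall>i\<ge>M. \<forall>j\<ge>M. L2_norm \<Omega> (\<lambda>x. s i x - s j x) < e / K"
      using cauchy[of "e/K"] e K by auto
    have "(LINT x|?M. norm (s i x - s j x)) < e" if "i \<ge> M" "j \<ge> M" for i j
    proof -
      have "K * L2_norm \<Omega> (\<lambda>x. s i x - s j x) < e"
        using M that K by (simp add: field_simps)
      then show ?thesis using L1_le[OF L2.diff_mem[OF s s], of i j] by linarith
    qed
    then show ?thesis by blast
  qed
  then obtain r where r: "strict_mono r" and aeC: "AE x in ?M. Cauchy (\<lambda>i. s (r i) x)"
    using cauchy_L1_AE_cauchy_subseq[of ?M s] L1 by blast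
  define u where "u x = lim (\<lambda>i. s (r i) x)" for x
  have [measurable]: "u \<in> borel_measurable ?M" unfolding u_def by measurable
  have lim: "AE x in ?M. (\<lambda>i. s (r i) x) \<longlonglongrightarrow> u x"
    using aeC
  proof eventually_elim
    case (elim x)
    then show ?case using real_Cauchy_convergent convergent_LIMSEQ_iff unfolding u_def by blast
  qed
  have key: "integrable ?M (\<lambda>x. (s n x - u x)\<^sup>2) \<and> (LINT x|?M. (s n x - u x)\<^sup>2) \<le> e\<^sup>2"
    if e: "e > 0" and M: "\<forall>m\<ge>M. \<forall>n\<ge>M. L2_norm \<Omega> (\<lambda>x. s m x - s n x) < e" and n: "n \<ge> M" for e M n
  proof -
    have "(\<integral>\<^sup>+x. ennreal ((s n x - u x)\<^sup>2) \<partial>?M) = (\<integral>\<^sup>+x. liminf (\<lambda>i. ennreal ((s n x - s (r i) x)\<^sup>2)) \<partial>?M)"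
    proof (rule nn_integral_cong_AE)
      show "AE x in ?M. ennreal ((s n x - u x)\<^sup>2) = liminf (\<lambda>i. ennreal ((s n x - s (r i) x)\<^sup>2))"
        using lim
      proof eventually_elim
        case (elim x)
        have "(\<lambda>i. ennreal ((s n x - s (r i) x)\<^sup>2)) \<longlonglongrightarrow> ennreal ((s n x - u x)\<^sup>2)"
          using elim by (intro tendsto_intros)
        then show ?case by (intro lim_imp_Liminf[symmetric]) auto
      qed
    qed
    also have "\<dots> \<le> liminf (\<lambda>i. \<integral>\<^sup>+x. ennreal ((s n x - s (r i) x)\<^sup>2) \<partial>?M)"
      by (rule nn_integral_liminf) measurable
    also have "\<dots> \<le> ennreal (e\<^sup>2)"
    proof (rule Liminf_le)
      show "\<forall>\<^sub>F i in sequentially. (\<integral>\<^sup>+x. ennreal ((s n x - s (r i) x)\<^sup>2) \<partial>?M) \<le> ennreal (e\<^sup>2)"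
        unfolding eventually_sequentially
      proof (intro exI allI impI)
        fix i assume "M \<le> i"
        then have "r i \<ge> M" using seq_suble[OF r, of i] by linarith
        have d: "(\<lambda>x. s n x - s (r i) x) \<in> L2_space \<Omega>" by (rule L2.diff_mem[OF s s])
        have "(L2_norm \<Omega> (\<lambda>x. s n x - s (r i) x))\<^sup>2 \<le> e\<^sup>2"
          using M n \<open>r i \<ge> M\<close> L2.seminorm_nonneg[OF d] by (intro power_mono) (auto simp: less_imp_le)
        then have "(LINT x|?M. (s n x - s (r i) x)\<^sup>2) \<le> e\<^sup>2"
          unfolding L2.seminorm_power2[OF d] by (simp add: L2_inner_def power2_eq_square)
        moreover have "(\<integral>\<^sup>+x. ennreal ((s n x - s (r i) x)\<^sup>2) \<partial>?M) = ennreal (LINT x|?M. (s n x - s (r i) x)\<^sup>2)"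
          using d by (intro nn_integral_eq_integral) (auto simp: L2_space_def)
        ultimately show "(\<integral>\<^sup>+x. ennreal ((s n x - s (r i) x)\<^sup>2) \<partial>?M) \<le> ennreal (e\<^sup>2)"
          by (simp add: ennreal_leI)
      qed
    qed simp
    finally have le: "(\<integral>\<^sup>+x. ennreal ((s n x - u x)\<^sup>2) \<partial>?M) \<le> ennreal (e\<^sup>2)" .
    have int: "integrable ?M (\<lambda>x. (s n x - u x)\<^sup>2)"
      by (rule integrableI_bounded) (use le in \<open>auto simp: less_top[symmetric] top_unique\<close>)
    have "ennreal (LINT x|?M. (s n x - u x)\<^sup>2) \<le> ennreal (e\<^sup>2)"
      using le nn_integral_eq_integral[OF int] by simp
    with int show ?thesis by (simp add: ennreal_le_iff)
  qed
  have d_mem: "(\<lambda>x. s n x - u x) \<in> L2_space \<Omega>" if "n \<ge> M"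
    "\<forall>m\<ge>M. \<forall>n\<ge>M. L2_norm \<Omega> (\<lambda>x. s m x - s n x) < 1" for n M
    using key[of 1 M n] that by (simp add: L2_space_def)
  obtain M1 where "\<forall>m\<ge>M1. \<forall>n\<ge>M1. L2_norm \<Omega> (\<lambda>x. s m x - s n x) < 1"
    using cauchy[of 1] by auto
  then have "(\<lambda>x. s M1 x - u x) \<in> L2_space \<Omega>" using d_mem[of M1 M1] by simp
  from L2.diff_mem[OF s[of M1] this] have u: "u \<in> L2_space \<Omega>" by simp
  have "(\<lambda>n. L2_norm \<Omega> (\<lambda>x. s n x - u x)) \<longlonglongrightarrow> 0"
  proof (rule LIMSEQ_I)
    fix e :: real assume e: "e > 0"
    then obtain M where M: "\<forall>m\<ge>M. \<forall>n\<ge>M. L2_norm \<Omega> (\<lambda>x. s m x - s n x) < e/2"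
      using cauchy[of "e/2"] by auto
    have "norm (L2_norm \<Omega> (\<lambda>x. s n x - u x) - 0) < e" if "n \<ge> M" for n
    proof -
      have "(L2_norm \<Omega> (\<lambda>x. s n x - u x))\<^sup>2 \<le> (e/2)\<^sup>2"
        using key[OF _ M that] e
        unfolding L2.seminorm_power2[OF L2.diff_mem[OF s u]] by (simp add: L2_inner_def power2_eq_square)
      then have "L2_norm \<Omega> (\<lambda>x. s n x - u x) \<le> e/2"
        by (rule power2_le_imp_le) (use e in simp)
      then show ?thesis using e L2.seminorm_nonneg[OF L2.diff_mem[OF s u], of n] by simp
    qed
    then show "\<exists>no. \<forall>n\<ge>no. norm (L2_norm \<Omega> (\<lambda>x. s n x - u x) - 0) < e" by blast
  qed
  then show "\<exists>u\<in>L2_space \<Omega>. (\<lambda>n. L2_norm \<Omega> (\<lambda>x. s n x - u x)) \<longlonglongrightarrow> 0"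
    using u by (intro bexI[of _ u])
qed

section \<open>Smooth functions and the vanishing integral of a partial derivative\<close>

lemma partial_deriv_eqI:
  "(f has_derivative f') (at x) \<Longrightarrow> partial_deriv i f x = f' (axis i 1)"
  unfolding partial_deriv_def by (metis frechet_derivative_at)

lemma partial_deriv_lin:
  assumes "f differentiable (at x)" "g differentiable (at x)"
  shows "partial_deriv i (\<lambda>x. f x + c * g x) x = partial_deriv i f x + c * partial_deriv i g x"
proof -
  have "((\<lambda>x. f x + c * g x) has_derivative
      (\<lambda>h. frechet_derivative f (at x) h + c * frechet_derivative g (at x) h)) (at x)"
    using assms by (intro derivative_intros) (auto simp: frechet_derivative_works)
  then show ?thesis by (simp add: partial_deriv_eqI) (simp add: partial_deriv_def)
qed

lemma partial_deriv_mult: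
  assumes "f differentiable (at x)" "g differentiable (at x)"
  shows "partial_deriv i (\<lambda>x. f x * g x) x = f x * partial_deriv i g x + partial_deriv i f x * g x"
proof -
  have "((\<lambda>x. f x * g x) has_derivative
      (\<lambda>h. f x * frechet_derivative g (at x) h + frechet_derivative f (at x) h * g x)) (at x)"
    using assms by (intro has_derivative_mult) (auto simp: frechet_derivative_works)
  then show ?thesis by (simp add: partial_deriv_eqI) (simp add: partial_deriv_def)
qed

lemma C_diff_partial_deriv: "C_diff (Suc k) f \<Longrightarrow> C_diff k (partial_deriv i f)"
  by simp

lemma C_diff_Suc_imp: "C_diff (Suc k) f \<Longrightarrow> C_diff k f"
proof (induction k arbitrary: f)
  case 0
  then show ?case
    by (simp add: continuous_at_imp_continuous_on differentiable_imp_continuous_within)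
next
  case (Suc k)
  then show ?case by (metis C_diff.simps(2))
qed

lemma C_diff_continuous: "C_diff k f \<Longrightarrow> continuous_on UNIV f"
proof (induction k arbitrary: f)
  case (Suc k)
  show ?case by (rule Suc.IH[OF C_diff_Suc_imp[OF Suc.prems]])
qed simp

lemma C_diff_lin:
  "C_diff k f \<Longrightarrow> C_diff k g \<Longrightarrow> C_diff k (\<lambda>x. f x + c * g x)"
proof (induction k arbitrary: f g)
  case 0
  then show ?case by (auto intro!: continuous_intros)
next
  case (Suc k)
  have "partial_deriv i (\<lambda>x. f x + c * g x) = (\<lambda>x. partial_deriv i f x + c * partial_deriv i g x)" for i
    using Suc.prems by (intro ext partial_deriv_lin) auto
  then show ?case using Suc by auto
qed

lemma C_diff_mult:
  "C_diff k f \<Longrightarrow> C_diff k g \<Longrightarrow> C_diff k (\<lambda>x. f x * g x)"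
proof (induction k arbitrary: f g)
  case 0
  then show ?case by (auto intro!: continuous_intros)
next
  case (Suc k)
  have "partial_deriv i (\<lambda>x. f x * g x) = (\<lambda>x. f x * partial_deriv i g x + 1 * (partial_deriv i f x * g x))" for i
    using Suc.prems by (intro ext) (simp add: partial_deriv_mult)
  moreover have "C_diff k (\<lambda>x. f x * partial_deriv i g x + 1 * (partial_deriv i f x * g x))" for i
    by (intro C_diff_lin Suc.IH C_diff_Suc_imp[OF Suc.prems(1)] C_diff_Suc_imp[OF Suc.prems(2)]
        C_diff_partial_deriv[OF Suc.prems(1)] C_diff_partial_deriv[OF Suc.prems(2)])
  ultimately show ?case using Suc.prems by (simp add: differentiable_mult)
qed

lemma C_diff_const: "C_diff k (\<lambda>x. c)"
proof (induction k arbitrary: c)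
  case (Suc k)
  have "partial_deriv i (\<lambda>x. c) = (\<lambda>x. 0)" for i :: 'a
    by (rule ext) (simp add: partial_deriv_def)
  then show ?case using Suc by simp
qed simp

lemma partial_deriv_nth: "partial_deriv i (\<lambda>x. x $ j) x = (if i = j then 1 else 0)"
proof -
  have "((\<lambda>x. x $ j) has_derivative (\<lambda>h. h $ j)) (at x)"
    by (rule bounded_linear_imp_has_derivative) (rule bounded_linear_vec_nth)
  then show ?thesis by (auto simp: partial_deriv_eqI axis_def)
qed

lemma C_diff_nth: "C_diff k (\<lambda>x. x $ j)"
proof (cases k)
  case (Suc l)
  have "partial_deriv i (\<lambda>x. x $ j) = (\<lambda>x. if i = j then 1 else 0)" for i :: 'a
    by (rule ext) (rule partial_deriv_nth)
  moreover have "(\<lambda>x. x $ j) differentiable (at x)" for x :: "real^'a"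
    by (rule bounded_linear_imp_differentiable) (rule bounded_linear_vec_nth)
  ultimately show ?thesis unfolding Suc by (auto simp: C_diff_const)
qed (auto intro!: continuous_intros)

lemma partial_deriv_zero_outside:
  assumes "closed K" "\<And>x. x \<notin> K \<Longrightarrow> w x = 0" "x \<notin> K"
  shows "partial_deriv i w x = 0"
proof -
  have "(w has_derivative (\<lambda>h. 0)) (at x)"
    by (rule has_derivative_transform_within_open[of "\<lambda>x. 0" _ _ _ "- K"])
      (use assms in \<open>auto simp: open_Compl\<close>)
  then show ?thesis by (simp add: partial_deriv_eqI)
qed

lemma continuous_compact_support_bounded:
  fixes w :: "real^'n \<Rightarrow> real"
  assumes "continuous_on UNIV w" "compact K" "\<And>x. x \<notin> K \<Longrightarrow> w x = 0"
  obtains B where "B > 0" "\<And>x. \<bar>w x\<bar> \<le> B"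
proof -
  have "bounded (w ` K)"
    by (intro compact_imp_bounded compact_continuous_image assms(2) continuous_on_subset[OF assms(1)]) simp
  then obtain B where "B > 0" "\<forall>y\<in>w ` K. norm y \<le> B" using bounded_pos by blast
  then have "\<bar>w x\<bar> \<le> B" for x using assms(3)[of x] by (cases "x \<in> K") auto
  then show ?thesis using that \<open>B > 0\<close> by blast
qed

lemma integral_translation_lborel:
  fixes f :: "'a::euclidean_space \<Rightarrow> real"
  assumes "f \<in> borel_measurable borel"
  shows "(LINT x|lborel. f (x + c)) = (LINT x|lborel. f x)"
proof -
  have "(LINT x|lborel. f x) = (LINT x|distr lborel borel ((+) c). f x)"
    by (simp add: lborel_distr_plus)
  also have "\<dots> = (LINT x|lborel. f (c + x))"
    by (rule integral_distr) (use assms in auto)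
  finally show ?thesis by (simp add: add.commute)
qed

text \<open>Difference quotients in direction \<open>i\<close> integrate to zero because Lebesgue measure is invariant under
translations. They converge pointwise to the partial derivative and, by the mean value theorem and
the compact support, are dominated by a multiple of the indicator of a ball.\<close>

theorem integral_partial_deriv_eq_0:
  fixes w :: "real^'n \<Rightarrow> real"
  assumes w: "C_diff (Suc 0) w" and K: "compact K" and zero: "\<And>x. x \<notin> K \<Longrightarrow> w x = 0"
  shows "(LINT x|lborel. partial_deriv i w x) = 0"
proof -
  define e :: "real^'n" where "e = axis i 1"
  have cw: "continuous_on UNIV w" using C_diff_continuous[OF w] .
  have cd: "continuous_on UNIV (partial_deriv i w)" using w by simp
  have [measurable]: "w \<in> borel_measurable borel" using cw by (rule borel_measurable_continuous_onI)
  have [measurable]: "partial_deriv i w \<in> borel_measurable borel" using cd by (rule borel_measurable_continuous_onI)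
  have dzero: "partial_deriv i w x = 0" if "x \<notin> K" for x
    by (rule partial_deriv_zero_outside[of K]) (use K zero that compact_imp_closed in auto)
  obtain B where B: "B > 0" "\<And>x. \<bar>partial_deriv i w x\<bar> \<le> B"
    using continuous_compact_support_bounded[OF cd K dzero] by blast
  have "bounded K" by (rule compact_imp_bounded[OF K])
  then obtain R where R: "K \<subseteq> cball 0 R" by (auto simp: bounded_iff subset_eq)
  have along: "((\<lambda>s. w (x + s *\<^sub>R e)) has_real_derivative partial_deriv i w (x + s *\<^sub>R e)) (at s)" for x s
  proof -
    let ?D = "frechet_derivative w (at (x + s *\<^sub>R e))"
    have "(w has_derivative ?D) (at (x + s *\<^sub>R e))"
      using w frechet_derivative_works by auto
    then have "((\<lambda>s. w (x + s *\<^sub>R e)) has_derivative (\<lambda>h. ?D (h *\<^sub>R e))) (at s)"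
      by (rule has_derivative_compose[rotated]) (auto intro!: derivative_eq_intros)
    moreover have "?D (h *\<^sub>R e) = h * partial_deriv i w (x + s *\<^sub>R e)" for h
      using linear_cmul[OF linear_frechet_derivative, of w] w by (auto simp: partial_deriv_def e_def)
    ultimately show ?thesis by (simp add: has_field_derivative_def mult_commute_abs)
  qed
  define t where "t n = 1 / real (Suc n)" for n
  have t: "t n > 0" "t n \<le> 1" for n by (auto simp: t_def)
  have t_lim: "t \<longlonglongrightarrow> 0" unfolding t_def using LIMSEQ_Suc[OF lim_inverse_n'] by simp
  define q where "q n x = (w (x + t n *\<^sub>R e) - w x) / t n" for n x
  have integrable_w: "integrable lborel w"
  proof -
    have "integrable lborel (\<lambda>x. indicator K x *\<^sub>R w x)"
      by (rule borel_integrable_compact[OF K continuous_on_subset[OF cw]]) simp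
    moreover have "(\<lambda>x. indicator K x *\<^sub>R w x) = w"
      by (rule ext) (use zero in \<open>auto simp: indicator_def\<close>)
    ultimately show ?thesis by simp
  qed
  have integrable_shift: "integrable lborel (\<lambda>x. w (x + c))" for c
  proof -
    have "integrable (distr lborel borel ((+) c)) w" using integrable_w by (simp add: lborel_distr_plus)
    then show ?thesis by (subst (asm) integrable_distr_eq) (auto simp: add.commute)
  qed
  have q_int: "(LINT x|lborel. q n x) = 0" for n
    unfolding q_def using integrable_w integrable_shift integral_translation_lborel[of w "t n *\<^sub>R e"] by simp
  have norm_e: "norm e = 1" by (simp add: e_def)
  have "(\<lambda>n. LINT x|lborel. q n x) \<longlonglongrightarrow> (LINT x|lborel. partial_deriv i w x)"
  proof (rule integral_dominated_convergence[where w = "\<lambda>x. B * indicator (cball 0 (R + 1)) x"])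
    show "q n \<in> borel_measurable lborel" for n unfolding q_def by measurable
    show "integrable lborel (\<lambda>x::real^'n. B * indicator (cball 0 (R + 1)) x :: real)"
      using emeasure_bounded_finite[of "cball (0::real^'n) (R + 1)"]
      by (intro integrable_mult_right integrable_real_indicator) auto
    show "AE x in lborel. (\<lambda>n. q n x) \<longlonglongrightarrow> partial_deriv i w x"
    proof (rule AE_I2)
      fix x
      have "(\<lambda>h. (w (x + h *\<^sub>R e) - w x) / h) \<midarrow>0\<rightarrow> partial_deriv i w x"
        using along[of x 0] by (simp add: has_field_derivative_iff)
      then show "(\<lambda>n. q n x) \<longlonglongrightarrow> partial_deriv i w x"
        unfolding q_def
        by (rule filterlim_compose) (use t_lim t(1)[THEN less_imp_neq] in \<open>simp add: filterlim_at\<close>)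
    qed
    show "AE x in lborel. norm (q n x) \<le> B * indicator (cball 0 (R + 1)) x" for n
    proof (rule AE_I2)
      fix x
      obtain z where "w (x + t n *\<^sub>R e) - w (x + 0 *\<^sub>R e) = (t n - 0) * partial_deriv i w (x + z *\<^sub>R e)"
        using MVT2[OF t(1)[of n] along[of x]] by blast
      then have "q n x = partial_deriv i w (x + z *\<^sub>R e)" using t(1)[of n] by (simp add: q_def)
      then have 1: "norm (q n x) \<le> B" using B(2) by simp
      have 2: "q n x = 0" if x: "x \<notin> cball 0 (R + 1)"
      proof -
        have "norm x \<le> norm (x + t n *\<^sub>R e) + norm (t n *\<^sub>R e)"
          using norm_triangle_ineq4[of "x + t n *\<^sub>R e" "t n *\<^sub>R e"] by simp
        then have "norm (x + t n *\<^sub>R e) > R" "norm x > R"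
          using x t(2)[of n] t(1)[of n] norm_e by auto
        then have "x + t n *\<^sub>R e \<notin> K" "x \<notin> K" using R by auto
        then show ?thesis by (simp add: q_def zero)
      qed
      show "norm (q n x) \<le> B * indicator (cball 0 (R + 1)) x"
        using 1 2 by (auto simp: indicator_def)
    qed
  qed measurable
  then show ?thesis using q_int by (simp add: LIMSEQ_const_iff)
qed

section \<open>Test functions\<close>

lemma test_functionsI:
  assumes "\<And>k. C_diff k \<phi>" "compact K" "K \<subseteq> \<Omega>" "\<And>x. x \<notin> K \<Longrightarrow> \<phi> x = 0"
  shows "\<phi> \<in> test_functions \<Omega>"
proof -
  have sub: "closure {x. \<phi> x \<noteq> 0} \<subseteq> K"
    using assms by (intro closure_minimal compact_imp_closed) auto
  then have "compact (closure {x. \<phi> x \<noteq> 0})"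
    using bounded_subset[OF compact_imp_bounded[OF assms(2)] sub] by (simp add: compact_eq_bounded_closed)
  then show ?thesis using assms sub by (auto simp: test_functions_def)
qed

lemma test_functionsE:
  assumes "\<phi> \<in> test_functions \<Omega>"
  obtains K where "\<And>k. C_diff k \<phi>" "compact K" "K \<subseteq> \<Omega>" "\<And>x. x \<notin> K \<Longrightarrow> \<phi> x = 0"
proof (rule that)
  show "\<phi> x = 0" if "x \<notin> closure {x. \<phi> x \<noteq> 0}" for x
    using that closure_subset[of "{x. \<phi> x \<noteq> 0}"] by auto
qed (use assms in \<open>auto simp: test_functions_def\<close>)

lemma test_functions_partial_deriv:
  assumes "\<phi> \<in> test_functions \<Omega>"
  shows "partial_deriv i \<phi> \<in> test_functions \<Omega>"
proof -
  obtain K where K: "\<And>k. C_diff k \<phi>" "compact K" "K \<subseteq> \<Omega>" "\<And>x. x \<notin> K \<Longrightarrow> \<phi> x = 0"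
    using test_functionsE[OF assms] by blast
  show ?thesis
  proof (rule test_functionsI[OF _ K(2,3)])
    show "C_diff k (partial_deriv i \<phi>)" for k using K(1)[of "Suc k"] by simp
    show "partial_deriv i \<phi> x = 0" if "x \<notin> K" for x
      using K that by (intro partial_deriv_zero_outside[of K]) (auto simp: compact_imp_closed)
  qed
qed

lemma test_functions_lin:
  assumes "\<phi> \<in> test_functions \<Omega>" "\<psi> \<in> test_functions \<Omega>"
  shows "(\<lambda>x. \<phi> x + c * \<psi> x) \<in> test_functions \<Omega>"
proof -
  obtain K where K: "\<And>k. C_diff k \<phi>" "compact K" "K \<subseteq> \<Omega>" "\<And>x. x \<notin> K \<Longrightarrow> \<phi> x = 0"
    using test_functionsE[OF assms(1)] by blast
  obtain L where L: "\<And>k. C_diff k \<psi>" "compact L" "L \<subseteq> \<Omega>" "\<And>x. x \<notin> L \<Longrightarrow> \<psi> x = 0"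
    using test_functionsE[OF assms(2)] by blast
  show ?thesis
    by (rule test_functionsI[of _ "K \<union> L"]) (use K L in \<open>auto intro: C_diff_lin compact_Un\<close>)
qed

lemma test_functions_zero: "(\<lambda>x. 0) \<in> test_functions \<Omega>"
  by (rule test_functionsI[of _ "{}"]) (auto intro: C_diff_const)

lemma test_functions_bounded:
  assumes "\<phi> \<in> test_functions \<Omega>"
  obtains B where "B > 0" "\<And>x. \<bar>\<phi> x\<bar> \<le> B"
proof -
  obtain K where K: "\<And>k. C_diff k \<phi>" "compact K" "K \<subseteq> \<Omega>" "\<And>x. x \<notin> K \<Longrightarrow> \<phi> x = 0"
    using test_functionsE[OF assms] by blast
  show ?thesis
    using continuous_compact_support_bounded[OF C_diff_continuous[OF K(1)] K(2,4)] that by blast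
qed

lemma continuous_imp_measurable_lebesgue_on:
  assumes "continuous_on UNIV f"
  shows "f \<in> borel_measurable (lebesgue_on \<Omega>)"
  using borel_measurable_continuous_onI[OF assms]
  by (intro measurable_restrict_space1 measurable_completion) simp

lemma test_functions_measurable:
  "\<phi> \<in> test_functions \<Omega> \<Longrightarrow> \<phi> \<in> borel_measurable (lebesgue_on S)"
  by (auto simp: test_functions_def intro!: continuous_imp_measurable_lebesgue_on C_diff_continuous)

lemma bounded_measurable_in_L2:
  assumes "finite_measure (lebesgue_on \<Omega>)" "f \<in> borel_measurable (lebesgue_on \<Omega>)" "\<And>x. x \<in> \<Omega> \<Longrightarrow> \<bar>f x\<bar> \<le> B"
  shows "f \<in> L2_space \<Omega>"
proof -
  interpret finite_measure "lebesgue_on \<Omega>" by fact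
  have "integrable (lebesgue_on \<Omega>) (\<lambda>x. (f x)\<^sup>2)"
  proof (rule integrable_const_bound[of _ "B\<^sup>2"])
    show "AE x in lebesgue_on \<Omega>. norm ((f x)\<^sup>2) \<le> B\<^sup>2"
    proof (rule AE_I2)
      fix x assume "x \<in> space (lebesgue_on \<Omega>)"
      then show "norm ((f x)\<^sup>2) \<le> B\<^sup>2" using power_mono[OF assms(3)[of x], of 2] by simp
    qed
  qed (use assms in auto)
  then show ?thesis using assms by (simp add: L2_space_def)
qed

lemma test_functions_in_L2:
  assumes "finite_measure (lebesgue_on \<Omega>)" "\<phi> \<in> test_functions \<Omega>"
  shows "\<phi> \<in> L2_space \<Omega>"
proof -
  obtain B where "B > 0" "\<And>x. \<bar>\<phi> x\<bar> \<le> B" using test_functions_bounded[OF assms(2)] by blast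
  then show ?thesis using bounded_measurable_in_L2[OF assms(1) test_functions_measurable[OF assms(2)]] by blast
qed

lemma integral_lebesgue_on_partial_deriv_eq_0:
  fixes w :: "real^'n \<Rightarrow> real"
  assumes "\<Omega> \<in> sets lebesgue" and w: "C_diff (Suc 0) w" and K: "compact K" "K \<subseteq> \<Omega>"
    and zero: "\<And>x. x \<notin> K \<Longrightarrow> w x = 0"
  shows "(LINT x|lebesgue_on \<Omega>. partial_deriv i w x) = 0"
proof -
  have dzero: "partial_deriv i w x = 0" if "x \<notin> K" for x
    by (rule partial_deriv_zero_outside[of K]) (use K zero that compact_imp_closed in auto)
  have meas: "partial_deriv i w \<in> borel_measurable borel"
    using w by (intro borel_measurable_continuous_onI) simp
  have "(LINT x|lebesgue_on \<Omega>. partial_deriv i w x) = (LINT x|lebesgue. indicator \<Omega> x *\<^sub>R partial_deriv i w x)"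
    using assms(1) by (intro integral_restrict_space) auto
  also have "(\<lambda>x. indicator \<Omega> x *\<^sub>R partial_deriv i w x) = partial_deriv i w"
    by (rule ext) (use dzero K in \<open>auto simp: indicator_def\<close>)
  also have "integral\<^sup>L lebesgue (partial_deriv i w) = integral\<^sup>L lborel (partial_deriv i w)"
    by (rule integral_completion) (use meas in simp)
  also have "\<dots> = 0" by (rule integral_partial_deriv_eq_0[OF w K(1) zero])
  finally show ?thesis .
qed

lemma integration_by_parts_test_functions:
  fixes \<phi> \<psi> :: "real^'n \<Rightarrow> real"
  assumes \<Omega>: "\<Omega> \<in> sets lebesgue" "finite_measure (lebesgue_on \<Omega>)"
    and \<phi>: "\<phi> \<in> test_functions \<Omega>" and \<psi>: "\<psi> \<in> test_functions \<Omega>"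
  shows "L2_inner \<Omega> \<phi> (partial_deriv i \<psi>) = - L2_inner \<Omega> (partial_deriv i \<phi>) \<psi>"
proof -
  obtain K where K: "\<And>k. C_diff k \<phi>" "compact K" "K \<subseteq> \<Omega>" "\<And>x. x \<notin> K \<Longrightarrow> \<phi> x = 0"
    using test_functionsE[OF \<phi>] by blast
  obtain L where L: "\<And>k. C_diff k \<psi>"
    using test_functionsE[OF \<psi>] by blast
  have D: "\<phi> differentiable at x" "\<psi> differentiable at x" for x
    using K(1)[of 1] L[of 1] by simp_all
  note mem = test_functions_in_L2[OF \<Omega>(2)] test_functions_partial_deriv
  have "(LINT x|lebesgue_on \<Omega>. partial_deriv i (\<lambda>x. \<phi> x * \<psi> x) x) = 0"
    by (rule integral_lebesgue_on_partial_deriv_eq_0[OF \<Omega>(1) C_diff_mult K(2,3)]) (use K L in auto)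
  also have "partial_deriv i (\<lambda>x. \<phi> x * \<psi> x) = (\<lambda>x. \<phi> x * partial_deriv i \<psi> x + partial_deriv i \<phi> x * \<psi> x)"
    by (intro ext partial_deriv_mult D)
  finally have sum: "(LINT x|lebesgue_on \<Omega>. \<phi> x * partial_deriv i \<psi> x + partial_deriv i \<phi> x * \<psi> x) = 0" .
  have "integrable (lebesgue_on \<Omega>) (\<lambda>x. \<phi> x * partial_deriv i \<psi> x)"
    "integrable (lebesgue_on \<Omega>) (\<lambda>x. partial_deriv i \<phi> x * \<psi> x)"
    by (intro L2_mult_integrable mem \<phi> \<psi>)+
  from Bochner_Integration.integral_add[OF this] sum show ?thesis
    by (simp add: L2_inner_def)
qed

text \<open>Since \<open>\<partial>\<^sub>i (x\<^sub>i \<phi>\<^sup>2) = \<phi>\<^sup>2 + 2 x\<^sub>i \<phi> \<partial>\<^sub>i \<phi>\<close> has integral zero, the Cauchy-Schwarz inequality bounds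
\<open>\<parallel>\<phi>\<parallel>\<^sup>2\<close> by \<open>2 R \<parallel>\<partial>\<^sub>i \<phi>\<parallel> \<parallel>\<phi>\<parallel>\<close>.\<close>

lemma Poincare_test_functions:
  fixes \<phi> :: "real^'n \<Rightarrow> real"
  assumes \<Omega>: "\<Omega> \<in> sets lebesgue" "finite_measure (lebesgue_on \<Omega>)"
    and R: "\<Omega> \<subseteq> cball 0 R" "R \<ge> 0" and \<phi>: "\<phi> \<in> test_functions \<Omega>"
  shows "L2_norm \<Omega> \<phi> \<le> 2 * R * L2_norm \<Omega> (partial_deriv i \<phi>)"
proof -
  obtain K where K: "\<And>k. C_diff k \<phi>" "compact K" "K \<subseteq> \<Omega>" "\<And>x. x \<notin> K \<Longrightarrow> \<phi> x = 0"
    using test_functionsE[OF \<phi>] by blast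
  let ?w = "\<lambda>x. x $ i * (\<phi> x * \<phi> x)"
  let ?d = "partial_deriv i \<phi>"
  let ?g = "\<lambda>x. x $ i * ?d x"
  have D: "\<phi> differentiable at x" for x using K(1)[of 1] by simp
  have "(\<lambda>x. x $ i) differentiable at x" for x :: "real^'n" using C_diff_nth[of 1 i] by simp
  then have dw: "partial_deriv i ?w = (\<lambda>x. \<phi> x * \<phi> x + 2 * (?g x * \<phi> x))"
    by (intro ext) (simp add: partial_deriv_mult partial_deriv_nth D differentiable_mult algebra_simps)
  have 0: "(LINT x|lebesgue_on \<Omega>. partial_deriv i ?w x) = 0"
    by (rule integral_lebesgue_on_partial_deriv_eq_0[OF \<Omega>(1) _ K(2,3)])
      (use K C_diff_nth in \<open>auto intro!: C_diff_mult simp del: C_diff.simps\<close>)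
  have L: "\<phi> \<in> L2_space \<Omega>" "?d \<in> L2_space \<Omega>"
    using test_functions_in_L2[OF \<Omega>(2)] test_functions_partial_deriv \<phi> by blast+
  have comp: "\<bar>x $ i\<bar> \<le> R" if "x \<in> \<Omega>" for x
    using that R component_le_norm_cart[of x i] by fastforce
  have g_le: "(?g x)\<^sup>2 \<le> R\<^sup>2 * (?d x)\<^sup>2" if "x \<in> \<Omega>" for x
    using power_mono[OF comp[OF that], of 2] by (simp add: power_mult_distrib mult_right_mono)
  have g_meas: "?g \<in> borel_measurable (lebesgue_on \<Omega>)"
    by (intro borel_measurable_times continuous_imp_measurable_lebesgue_on
        test_functions_measurable[OF test_functions_partial_deriv[OF \<phi>]] continuous_intros)
  have int_d: "integrable (lebesgue_on \<Omega>) (\<lambda>x. R\<^sup>2 * (?d x)\<^sup>2)" using L by (simp add: L2_space_def)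
  have "integrable (lebesgue_on \<Omega>) (\<lambda>x. (?g x)\<^sup>2)"
    by (rule Bochner_Integration.integrable_bound[OF int_d]) (use g_le g_meas in auto)
  then have g: "?g \<in> L2_space \<Omega>" using g_meas by (simp add: L2_space_def)
  have "(L2_norm \<Omega> ?g)\<^sup>2 \<le> (R * L2_norm \<Omega> ?d)\<^sup>2"
  proof -
    have "(LINT x|lebesgue_on \<Omega>. (?g x)\<^sup>2) \<le> (LINT x|lebesgue_on \<Omega>. R\<^sup>2 * (?d x)\<^sup>2)"
      using g int_d g_le by (intro integral_mono) (auto simp: L2_space_def)
    then show ?thesis
      unfolding power_mult_distrib[of R] L2.seminorm_power2[OF g] L2.seminorm_power2[OF L(2)]
      by (simp add: L2_inner_def power2_eq_square[symmetric])
  qed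
  then have g_norm: "L2_norm \<Omega> ?g \<le> R * L2_norm \<Omega> ?d"
    by (rule power2_le_imp_le) (use R L2.seminorm_nonneg[OF L(2)] in simp)
  have "L2_inner \<Omega> \<phi> \<phi> = - 2 * L2_inner \<Omega> ?g \<phi>"
    using 0 L2_mult_integrable[OF L(1,1)] L2_mult_integrable[OF g L(1)]
    unfolding dw by (simp add: L2_inner_def)
  then have "(L2_norm \<Omega> \<phi>)\<^sup>2 \<le> 2 * \<bar>L2_inner \<Omega> ?g \<phi>\<bar>"
    unfolding L2.seminorm_power2[OF L(1)] by linarith
  also have "\<dots> \<le> 2 * (R * L2_norm \<Omega> ?d * L2_norm \<Omega> \<phi>)"
    using L2.Cauchy_Schwarz[OF g L(1)] mult_right_mono[OF g_norm L2.seminorm_nonneg[OF L(1)]] by linarith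
  finally have *: "L2_norm \<Omega> \<phi> * L2_norm \<Omega> \<phi> \<le> (2 * R * L2_norm \<Omega> ?d) * L2_norm \<Omega> \<phi>"
    by (simp add: power2_eq_square mult.assoc)
  show ?thesis
  proof (cases "L2_norm \<Omega> \<phi> > 0")
    case True
    then show ?thesis using * by (rule mult_right_le_imp_le[rotated])
  next
    case False
    moreover have "0 \<le> 2 * R * L2_norm \<Omega> ?d" using R(2) L2.seminorm_nonneg[OF L(2)] by simp
    ultimately show ?thesis by linarith
  qed
qed

section \<open>Bump functions and the fundamental lemma of the calculus of variations\<close>

text \<open>Derivatives of \<open>exp (- 1/t)\<close> have the form \<open>p (1/t) * exp (- 1/t)\<close> with a polynomial \<open>p\<close>. Carrying \<open>p\<close> as a
parameter makes the family closed under differentiation, so smoothness is a plain induction.\<close>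

definition flat_exp :: "real poly \<Rightarrow> real \<Rightarrow> real" where
  "flat_exp p t = (if t > 0 then poly p (1/t) * exp (- (1/t)) else 0)"

lemma poly_times_exp_minus_tendsto_0:
  "((\<lambda>s. poly p s * exp (- s)) \<longlongrightarrow> (0::real)) at_top"
proof -
  have "((\<lambda>s. \<Sum>k\<le>degree p. coeff p k * (s ^ k / exp s)) \<longlongrightarrow> (\<Sum>k\<le>degree p. coeff p k * 0)) at_top"
    by (intro tendsto_intros tendsto_power_div_exp_0)
  moreover have "(\<Sum>k\<le>degree p. coeff p k * (s ^ k / exp s)) = poly p s * exp (- s)" for s
    by (simp add: poly_altdef sum_distrib_right exp_minus divide_inverse mult.assoc)
  ultimately show ?thesis by simp
qed

lemma flat_exp_has_derivative:
  "(flat_exp p has_real_derivative flat_exp ([:0, 0, 1:] * (p - pderiv p)) t) (at t)"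
proof -
  let ?q = "[:0, 0, 1:] * (p - pderiv p)"
  consider "t > 0" | "t < 0" | "t = 0" by linarith
  then show ?thesis
  proof cases
    case 1
    have "((\<lambda>t. poly p (1/t) * exp (- (1/t))) has_real_derivative flat_exp ?q t) (at t)"
      using 1 by (auto intro!: derivative_eq_intros simp: flat_exp_def field_simps power2_eq_square)
    then show ?thesis
      by (rule has_field_derivative_transform_within_open[of _ _ _ "{0<..}"])
        (use 1 in \<open>auto simp: flat_exp_def\<close>)
  next
    case 2
    have "((\<lambda>t. 0) has_real_derivative flat_exp ?q t) (at t)"
      using 2 by (simp add: flat_exp_def)
    then show ?thesis
      by (rule has_field_derivative_transform_within_open[of _ _ _ "{..<0}"])
        (use 2 in \<open>auto simp: flat_exp_def\<close>)
  next
    case 3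
    have "((\<lambda>h. flat_exp p h / h) \<longlongrightarrow> 0) (at 0)"
      unfolding filterlim_split_at
    proof (rule filterlim_split_at)
      have "\<forall>\<^sub>F h in at_left (0::real). flat_exp p h / h = 0"
        by (auto simp: eventually_at_filter flat_exp_def)
      then show "((\<lambda>h. flat_exp p h / h) \<longlongrightarrow> 0) (at_left 0)"
        by (rule tendsto_eventually)
      have "((\<lambda>h. poly (pCons 0 p) (inverse h) * exp (- inverse h)) \<longlongrightarrow> 0) (at_right (0::real))"
        by (rule filterlim_compose[OF poly_times_exp_minus_tendsto_0 filterlim_inverse_at_top_right])
      moreover have "\<forall>\<^sub>F h in at_right (0::real).
          poly (pCons 0 p) (inverse h) * exp (- inverse h) = flat_exp p h / h"
        by (auto simp: eventually_at_filter flat_exp_def inverse_eq_divide)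
      ultimately show "((\<lambda>h. flat_exp p h / h) \<longlongrightarrow> 0) (at_right 0)"
        by (rule Lim_transform_eventually)
    qed
    then show ?thesis
      using 3 by (simp add: has_field_derivative_iff) (simp add: flat_exp_def)
  qed
qed

lemma C_diff_flat_exp: "C_diff k (\<lambda>x. flat_exp p (c * x $ j + d))"
proof (induction k arbitrary: p)
  case 0
  have "continuous_on UNIV (flat_exp p)"
    using flat_exp_has_derivative by (intro continuous_at_imp_continuous_on ballI DERIV_isCont)
  then have "continuous_on UNIV (\<lambda>x. flat_exp p (c * x $ j + d))"
    by (rule continuous_on_compose2) (auto intro!: continuous_intros)
  then show ?case by simp
next
  case (Suc k)
  let ?q = "[:0, 0, 1:] * (p - pderiv p)"
  have D: "((\<lambda>x. flat_exp p (c * x $ j + d)) has_derivative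
      (\<lambda>h. flat_exp ?q (c * x $ j + d) * (c * h $ j))) (at x)" for x :: "real^'a"
  proof -
    have "((\<lambda>x. c * x $ j + d) has_derivative (\<lambda>h. c * h $ j)) (at x)"
      by (auto intro!: derivative_eq_intros bounded_linear_imp_has_derivative bounded_linear_vec_nth)
    from has_derivative_compose[OF this] flat_exp_has_derivative show ?thesis
      unfolding has_field_derivative_def by blast
  qed
  have "partial_deriv i (\<lambda>x. flat_exp p (c * x $ j + d)) =
      (\<lambda>x. 0 + (if i = j then c else 0) * flat_exp ?q (c * x $ j + d))" for i
    by (rule ext) (auto simp: partial_deriv_eqI[OF D] axis_def)
  moreover have "C_diff k (\<lambda>x. 0 + (if i = j then c else 0) * flat_exp ?q (c * x $ j + d))" for i
    by (rule C_diff_lin[OF C_diff_const Suc.IH])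
  moreover have "(\<lambda>x. flat_exp p (c * x $ j + d)) differentiable (at x)" for x :: "real^'a"
    using D by (rule differentiableI)
  ultimately show ?case by simp
qed

lemma C_diff_prod:
  "finite A \<Longrightarrow> (\<And>i. i \<in> A \<Longrightarrow> C_diff k (f i)) \<Longrightarrow> C_diff k (\<lambda>x. \<Prod>i\<in>A. f i x)"
  by (induction A rule: finite_induct) (auto intro: C_diff_const C_diff_mult)

text \<open>A product of one-dimensional transitions, positive exactly on the open box; as \<open>n\<close> grows it increases
to the indicator function of the box.\<close>

definition box_bump :: "nat \<Rightarrow> real^'n \<Rightarrow> real^'n \<Rightarrow> real^'n \<Rightarrow> real" where
  "box_bump n a b x = (\<Prod>i\<in>UNIV.
     flat_exp 1 (real (Suc n) * (x $ i - a $ i)) * flat_exp 1 (real (Suc n) * (b $ i - x $ i)))"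

lemma flat_exp_1_bounds: "0 \<le> flat_exp 1 t" "flat_exp 1 t \<le> 1"
  by (auto simp: flat_exp_def)

lemma flat_exp_1_nonpos: "t \<le> 0 \<Longrightarrow> flat_exp 1 t = 0"
  by (simp add: flat_exp_def)

lemma box_bump_bounds: "0 \<le> box_bump n a b x" "box_bump n a b x \<le> 1"
  unfolding box_bump_def
  by (auto intro!: prod_nonneg prod_le_1 mult_nonneg_nonneg mult_le_one flat_exp_1_bounds)

lemma box_bump_outside:
  assumes "x \<notin> box a b"
  shows "box_bump n a b x = 0"
proof -
  obtain i where "x $ i \<le> a $ i \<or> b $ i \<le> x $ i"
    using assms by (auto simp: mem_box_cart not_less)
  then have "real (Suc n) * (x $ i - a $ i) \<le> 0 \<or> real (Suc n) * (b $ i - x $ i) \<le> 0"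
    by (auto simp: mult_le_0_iff)
  then have "flat_exp 1 (real (Suc n) * (x $ i - a $ i)) * flat_exp 1 (real (Suc n) * (b $ i - x $ i)) = 0"
    using flat_exp_1_nonpos by (metis mult_eq_0_iff)
  then show ?thesis unfolding box_bump_def by (intro prod_zero bexI[of _ i]) auto
qed

lemma box_bump_test_function:
  assumes "cbox a b \<subseteq> \<Omega>"
  shows "box_bump n a b \<in> test_functions \<Omega>"
proof (rule test_functionsI[of _ "cbox a b"])
  have "C_diff k (\<lambda>x. flat_exp 1 (real (Suc n) * (x $ i - a $ i)))" for k i
    using C_diff_flat_exp[of k 1 "real (Suc n)" i "- (real (Suc n) * a $ i)"]
    by (simp only: right_diff_distrib add_uminus_conv_diff)
  moreover have "C_diff k (\<lambda>x. flat_exp 1 (real (Suc n) * (b $ i - x $ i)))" for k i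
    using C_diff_flat_exp[of k 1 "- real (Suc n)" i "real (Suc n) * b $ i"]
    by (simp only: right_diff_distrib mult_minus_left uminus_add_conv_diff)
  ultimately show "C_diff k (box_bump n a b)" for k
    unfolding box_bump_def by (intro C_diff_prod C_diff_mult) simp_all
  show "box_bump n a b x = 0" if "x \<notin> cbox a b" for x
    using that box_bump_outside box_subset_cbox by blast
qed (use assms in auto)

lemma box_bump_tendsto: "(\<lambda>n. box_bump n a b x) \<longlonglongrightarrow> indicator (box a b) x"
proof (cases "x \<in> box a b")
  case True
  have 1: "(\<lambda>n. flat_exp 1 (real (Suc n) * s)) \<longlonglongrightarrow> 1" if "s > 0" for s
  proof -
    have "(\<lambda>n. exp (- (1 / real (Suc n) * (1 / s)))) \<longlonglongrightarrow> exp (- (0 * (1 / s)))"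
      by (intro tendsto_intros LIMSEQ_Suc[OF lim_inverse_n'])
    then show ?thesis using that by (simp add: flat_exp_def)
  qed
  have "(\<lambda>n. flat_exp 1 (real (Suc n) * (x $ i - a $ i)) * flat_exp 1 (real (Suc n) * (b $ i - x $ i)))
      \<longlonglongrightarrow> 1 * 1" for i
    using True by (intro tendsto_mult 1) (auto simp: mem_box_cart)
  then have "(\<lambda>n. box_bump n a b x) \<longlonglongrightarrow> (\<Prod>i\<in>(UNIV :: 'a set). 1 * 1)"
    unfolding box_bump_def by (rule tendsto_prod)
  then show ?thesis using True by simp
qed (simp add: box_bump_outside)

text \<open>Lebesgue's differentiation theorem: almost everywhere the value is the limit of averages over boxes
that shrink to the point, and these averages vanish.\<close>

lemma AE_eq_0_if_integral_boxes_eq_0: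
  fixes f :: "'a::euclidean_space \<Rightarrow> real"
  assumes int: "set_integrable lebesgue (cbox a b) f"
    and zero: "\<And>c d. cbox c d \<subseteq> cbox a b \<Longrightarrow> integral (cbox c d) f = 0"
  shows "\<exists>N. negligible N \<and> (\<forall>x\<in>box a b - N. f x = 0)"
proof -
  define g where "g x = (if x \<in> cbox a b then f x else 0)" for x
  have "f integrable_on cbox a b"
    using int by (simp add: set_lebesgue_integral_eq_integral)
  then have "g integrable_on UNIV" unfolding g_def by (simp add: integrable_restrict_UNIV)
  then have "g integrable_on cbox c d" for c d
    by (rule integrable_on_subcbox) simp
  then obtain N where N: "negligible N"
    "\<And>x e. x \<notin> N \<Longrightarrow> 0 < e \<Longrightarrow> \<exists>d>0. \<forall>h. 0 < h \<and> h < d \<longrightarrow>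
        norm (integral (cbox x (x + h *\<^sub>R One)) g /\<^sub>R h ^ DIM('a) - g x) < e"
    using integrable_ccontinuous_explicit[of g] by blast
  have "f x = 0" if x: "x \<in> box a b" "x \<notin> N" for x
  proof (rule ccontr)
    assume nz: "f x \<noteq> 0"
    then obtain d where d: "d > 0" "\<And>h. 0 < h \<Longrightarrow> h < d \<Longrightarrow>
        norm (integral (cbox x (x + h *\<^sub>R One)) g /\<^sub>R h ^ DIM('a) - g x) < \<bar>f x\<bar>"
      using N(2)[OF x(2), of "\<bar>f x\<bar>"] by auto
    define m where "m = Min ((\<lambda>i. (b - x) \<bullet> i) ` Basis)"
    have m: "m > 0" unfolding m_def using x(1) by (subst Min_gr_iff) (auto simp: mem_box inner_diff_left)
    have m_le: "m \<le> (b - x) \<bullet> i" if "i \<in> Basis" for i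
      unfolding m_def using that by (intro Min_le) auto
    \<comment> \<open>\<open>m\<close> is the distance of \<open>x\<close> to the upper faces, so \<open>h < m\<close> keeps the averaging box inside.\<close>
    define h where "h = min d m / 2"
    have h: "0 < h" "h < d" "h < m" using d(1) m by (auto simp: h_def min_def)
    have sub: "cbox x (x + h *\<^sub>R One) \<subseteq> cbox a b"
    proof
      fix y assume y: "y \<in> cbox x (x + h *\<^sub>R One)"
      have "a \<bullet> i \<le> y \<bullet> i \<and> y \<bullet> i \<le> b \<bullet> i" if i: "i \<in> Basis" for i
      proof -
        have "x \<bullet> i \<le> y \<bullet> i" "y \<bullet> i \<le> x \<bullet> i + h" "a \<bullet> i < x \<bullet> i"
          using y x(1) i by (auto simp: mem_box inner_left_distrib)
        moreover have "x \<bullet> i + h \<le> b \<bullet> i"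
          using m_le[OF i] h(3) by (simp add: inner_diff_left)
        ultimately show ?thesis by linarith
      qed
      then show "y \<in> cbox a b" by (simp add: mem_box)
    qed
    have "integral (cbox x (x + h *\<^sub>R One)) g = integral (cbox x (x + h *\<^sub>R One)) f"
      by (rule Henstock_Kurzweil_Integration.integral_cong) (use sub in \<open>auto simp: g_def\<close>)
    also have "\<dots> = 0" by (rule zero[OF sub])
    finally have "norm (g x) < \<bar>f x\<bar>" using d(2)[OF h(1,2)] by simp
    moreover have "g x = f x" using x(1) box_subset_cbox by (auto simp: g_def)
    ultimately show False by simp
  qed
  with N(1) show ?thesis by blast
qed

text \<open>Testing with bump functions that converge boundedly to the indicator of a box shows that the
integral over every closed box in \<open>\<Omega>\<close> vanishes; countably many such boxes cover \<open>\<Omega>\<close>.\<close>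

theorem fundamental_lemma_calculus_of_variations:
  fixes g :: "real^'n \<Rightarrow> real"
  assumes \<Omega>: "open \<Omega>" and g: "locally_integrable \<Omega> g"
    and zero: "\<And>\<phi>. \<phi> \<in> test_functions \<Omega> \<Longrightarrow> (LINT x|lebesgue_on \<Omega>. g x * \<phi> x) = 0"
  shows "AE x in lebesgue_on \<Omega>. g x = 0"
proof -
  have \<Omega>_sets: "\<Omega> \<in> sets lebesgue" using \<Omega> by (simp add: borel_open)
  have int: "set_integrable lebesgue (cbox c d) g" if "cbox c d \<subseteq> \<Omega>" for c d
    using g that by (simp add: locally_integrable_def)
  have box_zero: "integral (cbox c d) g = 0" if sub: "cbox c d \<subseteq> \<Omega>" for c d
  proof -
    let ?G = "\<lambda>x. indicator (cbox c d) x *\<^sub>R g x"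
    have G: "integrable lebesgue ?G" using int[OF sub] by (simp add: set_integrable_def)
    have lim: "(\<lambda>n. LINT x|lebesgue. ?G x * box_bump n c d x) \<longlonglongrightarrow> (LINT x|lebesgue. ?G x * indicator (box c d) x)"
    proof (rule integral_dominated_convergence[where w = "\<lambda>x. norm (?G x)"])
      show "integrable lebesgue (\<lambda>x. norm (?G x))" using G by (rule integrable_norm)
      show "(\<lambda>x. ?G x * indicator (box c d) x) \<in> borel_measurable lebesgue"
        using G by (intro borel_measurable_times borel_measurable_indicator) auto
      show "(\<lambda>x. ?G x * box_bump n c d x) \<in> borel_measurable lebesgue" for n
        using G test_functions_measurable[OF box_bump_test_function[OF sub], of n UNIV]
        by (intro borel_measurable_times) (auto simp: lebesgue_on_UNIV_eq)
      show "AE x in lebesgue. (\<lambda>n. ?G x * box_bump n c d x) \<longlonglongrightarrow> ?G x * indicator (box c d) x"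
        by (intro AE_I2 tendsto_mult tendsto_const box_bump_tendsto)
      show "AE x in lebesgue. norm (?G x * box_bump n c d x) \<le> norm (?G x)" for n
      proof (intro AE_I2)
        fix x
        have "\<bar>?G x\<bar> * \<bar>box_bump n c d x\<bar> \<le> \<bar>?G x\<bar> * 1"
          using box_bump_bounds[of n c d x] by (intro mult_left_mono) auto
        then show "norm (?G x * box_bump n c d x) \<le> norm (?G x)"
          by (simp only: real_norm_def abs_mult mult_1_right)
      qed
    qed
    have "(LINT x|lebesgue. ?G x * box_bump n c d x) = 0" for n
    proof -
      have "(LINT x|lebesgue_on \<Omega>. g x * box_bump n c d x) = (LINT x|lebesgue. indicator \<Omega> x *\<^sub>R (g x * box_bump n c d x))"
        using \<Omega>_sets by (intro integral_restrict_space) auto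
      also have "(\<lambda>x. indicator \<Omega> x *\<^sub>R (g x * box_bump n c d x)) = (\<lambda>x. ?G x * box_bump n c d x)"
      proof
        fix x
        show "indicator \<Omega> x *\<^sub>R (g x * box_bump n c d x) = ?G x * box_bump n c d x"
          using sub box_bump_outside[of x c d n] box_subset_cbox[of c d] by (cases "x \<in> box c d") (auto simp: indicator_def)
      qed
      finally show ?thesis using zero[OF box_bump_test_function[OF sub]] by simp
    qed
    then have "(LINT x|lebesgue. ?G x * indicator (box c d) x) = 0"
      using lim by (simp add: LIMSEQ_const_iff)
    moreover have "(\<lambda>x. ?G x * indicator (box c d) x) = (\<lambda>x. indicator (box c d) x *\<^sub>R g x)"
      using box_subset_cbox[of c d] by (intro ext) (auto simp: indicator_def)
    ultimately have "set_lebesgue_integral lebesgue (box c d) g = 0"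
      by (simp add: set_lebesgue_integral_def)
    moreover have "set_integrable lebesgue (box c d) g"
      by (rule set_integrable_subset[OF int[OF sub]]) (auto simp: box_subset_cbox)
    ultimately have "integral (box c d) g = 0" by (simp add: set_lebesgue_integral_eq_integral)
    then show ?thesis by (simp add: integral_open_interval)
  qed
  obtain \<D> where \<D>: "countable \<D>" "\<D> \<subseteq> Pow \<Omega>" "\<And>X. X \<in> \<D> \<Longrightarrow> \<exists>a b. X = cbox a b" "\<Union>\<D> = \<Omega>"
    using open_countable_Union_open_cbox[OF \<Omega>] by blast
  have "\<exists>N. negligible N \<and> (\<forall>x\<in>X - N. g x = 0)" if X: "X \<in> \<D>" for X
  proof -
    obtain a b where ab: "X = cbox a b" using \<D>(3)[OF X] by blast
    then have sub: "cbox a b \<subseteq> \<Omega>" using \<D>(2) X by blast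
    obtain N where N: "negligible N" "\<forall>x\<in>box a b - N. g x = 0"
      using AE_eq_0_if_integral_boxes_eq_0[OF int[OF sub]] box_zero sub by (meson order_trans)
    have "negligible (N \<union> (cbox a b - box a b))"
      using N(1) by (simp add: negligible_frontier_interval)
    moreover have "\<forall>x\<in>X - (N \<union> (cbox a b - box a b)). g x = 0" using N(2) ab by auto
    ultimately show ?thesis by blast
  qed
  then obtain N where N: "\<And>X. X \<in> \<D> \<Longrightarrow> negligible (N X)" "\<And>X. X \<in> \<D> \<Longrightarrow> \<forall>x\<in>X - N X. g x = 0"
    by metis
  have "negligible (\<Union>(N ` \<D>))" using \<D>(1) N(1) by (intro negligible_countable_Union) auto
  then have "\<Union>(N ` \<D>) \<in> null_sets lebesgue" by (simp add: negligible_iff_null_sets)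
  moreover have "\<forall>x\<in>\<Omega> - \<Union>(N ` \<D>). g x = 0" using \<D>(4) N(2) by blast
  ultimately have "AE x in lebesgue. x \<in> \<Omega> \<longrightarrow> g x = 0"
    by (intro AE_I'[of "\<Union>(N ` \<D>)"]) auto
  then show ?thesis using \<Omega>_sets by (subst AE_restrict_space_iff) auto
qed

section \<open>Weak derivatives on a bounded open set\<close>

text \<open>Membership in a Sobolev space is kept folded, so that it can serve as a carrier.\<close>

declare sobolev_H.simps [simp del]

locale bounded_open_set =
  fixes \<Omega> :: "(real^'n) set"
  assumes open_\<Omega>: "open \<Omega>" and bounded_\<Omega>: "bounded \<Omega>"
begin

lemma sets_\<Omega>: "\<Omega> \<in> sets lebesgue"
  using open_\<Omega> by (simp add: borel_open)

lemma finite_measure_\<Omega>: "finite_measure (lebesgue_on \<Omega>)"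
  by (intro finite_measure_lebesgue_on lmeasurable_open bounded_\<Omega> open_\<Omega>)

lemma L2_measurable: "f \<in> L2_space \<Omega> \<Longrightarrow> f \<in> borel_measurable (lebesgue_on \<Omega>)"
  by (simp add: L2_space_def)

lemma measurable_cong_AE:
  fixes f g :: "real^'n \<Rightarrow> real"
  assumes "f \<in> borel_measurable (lebesgue_on \<Omega>)" "AE x in lebesgue_on \<Omega>. f x = g x"
  shows "g \<in> borel_measurable (lebesgue_on \<Omega>)"
proof -
  have "AE x in lebesgue. (if x \<in> \<Omega> then f x else 0) = (if x \<in> \<Omega> then g x else 0)"
    using assms(2) sets_\<Omega> by (subst (asm) AE_restrict_space_iff) (auto elim: eventually_mono)
  then have "(\<lambda>x. if x \<in> \<Omega> then g x else 0) \<in> borel_measurable lebesgue"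
    by (rule borel_measurable_AE[rotated]) (rule borel_measurable_if_I[OF assms(1) sets_\<Omega>])
  then show ?thesis by (rule borel_measurable_if_D)
qed

lemma L2_cong:
  assumes "f \<in> L2_space \<Omega>" "AE x in lebesgue_on \<Omega>. f x = g x"
  shows "g \<in> L2_space \<Omega>"
  using L2_cong_AE[OF assms measurable_cong_AE[OF L2_measurable[OF assms(1)] assms(2)]] .

lemma L2_inner_cong:
  assumes "f \<in> L2_space \<Omega>" "g \<in> L2_space \<Omega>"
    "AE x in lebesgue_on \<Omega>. f x = f' x" "AE x in lebesgue_on \<Omega>. g x = g' x"
  shows "L2_inner \<Omega> f g = L2_inner \<Omega> f' g'"
  using L2_inner_cong_AE[OF assms(3,4)] assms(1,2) L2_cong[OF assms(1,3)] L2_cong[OF assms(2,4)]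
  by (simp add: L2_measurable)

lemma L2_norm_cong:
  assumes "f \<in> L2_space \<Omega>" "AE x in lebesgue_on \<Omega>. f x = f' x"
  shows "L2_norm \<Omega> f = L2_norm \<Omega> f'"
  unfolding L2_norm_def using L2_inner_cong[OF assms(1,1,2,2)] by simp

lemma L2_locally_integrable:
  assumes "f \<in> L2_space \<Omega>"
  shows "locally_integrable \<Omega> f"
  unfolding locally_integrable_def
proof (intro allI impI)
  fix K assume K: "compact K \<and> K \<subseteq> \<Omega>"
  interpret finite_measure "lebesgue_on \<Omega>" by (rule finite_measure_\<Omega>)
  have "(\<lambda>x. 1) \<in> L2_space \<Omega>" by (simp add: L2_space_def)
  from L2_mult_integrable[OF assms this] have "set_integrable lebesgue \<Omega> f"
    using sets_\<Omega> by (simp add: integrable_restrict_space set_integrable_def)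
  then show "set_integrable lebesgue K f"
  proof (rule set_integrable_subset)
    show "K \<in> sets lebesgue" using K by (simp add: compact_imp_closed borel_closed)
    show "K \<subseteq> \<Omega>" using K by (rule conjunct2)
  qed
qed

lemma integrable_mult_test_function:
  assumes g: "locally_integrable \<Omega> g" and \<phi>: "\<phi> \<in> test_functions \<Omega>"
  shows "integrable (lebesgue_on \<Omega>) (\<lambda>x. g x * \<phi> x)"
proof -
  obtain K where "\<And>k. C_diff k \<phi>" and K: "compact K" "K \<subseteq> \<Omega>" "\<And>x. x \<notin> K \<Longrightarrow> \<phi> x = 0"
    using test_functionsE[OF \<phi>] by blast
  obtain B where B: "B > 0" "\<And>x. \<bar>\<phi> x\<bar> \<le> B" using test_functions_bounded[OF \<phi>] by blast
  let ?G = "\<lambda>x. indicator K x *\<^sub>R g x"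
  have G: "integrable lebesgue ?G"
    using g K by (simp add: locally_integrable_def set_integrable_def)
  have "integrable lebesgue (\<lambda>x. ?G x * \<phi> x)"
  proof (rule Bochner_Integration.integrable_bound)
    show "integrable lebesgue (\<lambda>x. B * norm (?G x))"
      by (intro integrable_mult_right integrable_norm G)
    show "(\<lambda>x. ?G x * \<phi> x) \<in> borel_measurable lebesgue"
      using G test_functions_measurable[OF \<phi>, of UNIV]
      by (intro borel_measurable_times) (auto simp: lebesgue_on_UNIV_eq)
    show "AE x in lebesgue. norm (?G x * \<phi> x) \<le> norm (B * norm (?G x))"
    proof (rule AE_I2)
      fix x
      have "\<bar>?G x\<bar> * \<bar>\<phi> x\<bar> \<le> \<bar>?G x\<bar> * B" by (intro mult_left_mono B) simp
      then show "norm (?G x * \<phi> x) \<le> norm (B * norm (?G x))"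
        using B(1) by (simp only: real_norm_def abs_mult abs_abs abs_of_pos mult.commute)
    qed
  qed
  moreover have "(\<lambda>x. ?G x * \<phi> x) = (\<lambda>x. indicator \<Omega> x *\<^sub>R (g x * \<phi> x))"
    by (rule ext) (use K in \<open>auto simp: indicator_def\<close>)
  ultimately show ?thesis using sets_\<Omega> by (simp add: integrable_restrict_space)
qed

lemma locally_integrable_lin:
  assumes "locally_integrable \<Omega> f" "locally_integrable \<Omega> g"
  shows "locally_integrable \<Omega> (\<lambda>x. f x + c * g x)"
  using assms unfolding locally_integrable_def
  by (auto intro!: set_integral_add(1) set_integrable_mult_right)

text \<open>Uniqueness is what makes the representative selected in the definition of a weak derivative
harmless: all forms built from it are linear, although the selection itself is linear only up to
null sets.\<close>

lemma has_weak_partial_unique: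
  assumes "has_weak_partial \<Omega> i f g" "has_weak_partial \<Omega> i f h"
  shows "AE x in lebesgue_on \<Omega>. g x = h x"
proof -
  have l: "locally_integrable \<Omega> g" "locally_integrable \<Omega> h"
    using assms by (simp_all add: has_weak_partial_def)
  have "AE x in lebesgue_on \<Omega>. g x + (-1) * h x = 0"
  proof (rule fundamental_lemma_calculus_of_variations[OF open_\<Omega> locally_integrable_lin[OF l]])
    fix \<phi> assume \<phi>: "\<phi> \<in> test_functions \<Omega>"
    have "(LINT x|lebesgue_on \<Omega>. g x * \<phi> x) = (LINT x|lebesgue_on \<Omega>. h x * \<phi> x)"
      using assms \<phi> by (simp add: has_weak_partial_def)
    then show "(LINT x|lebesgue_on \<Omega>. (g x + (-1) * h x) * \<phi> x) = 0"
      using integrable_mult_test_function[OF l(1) \<phi>] integrable_mult_test_function[OF l(2) \<phi>]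
      by (simp add: left_diff_distrib)
  qed
  then show ?thesis by simp
qed

lemma has_weak_partial_weak_partial:
  "has_weak_partial \<Omega> i f g \<Longrightarrow> has_weak_partial \<Omega> i f (weak_partial \<Omega> i f)"
  unfolding weak_partial_def by (rule someI[where P = "has_weak_partial \<Omega> i f"])

lemma weak_partial_AE:
  "has_weak_partial \<Omega> i f g \<Longrightarrow> AE x in lebesgue_on \<Omega>. g x = weak_partial \<Omega> i f x"
  using has_weak_partial_unique has_weak_partial_weak_partial by blast

lemma has_weak_partial_L2_iff:
  assumes "f \<in> L2_space \<Omega>" "g \<in> L2_space \<Omega>"
  shows "has_weak_partial \<Omega> i f g \<longleftrightarrow>
    (\<forall>\<phi>\<in>test_functions \<Omega>. L2_inner \<Omega> f (partial_deriv i \<phi>) = - L2_inner \<Omega> g \<phi>)"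
  using assms by (simp add: has_weak_partial_def L2_inner_def L2_locally_integrable)

lemma test_L2: "\<phi> \<in> test_functions \<Omega> \<Longrightarrow> \<phi> \<in> L2_space \<Omega>"
  by (rule test_functions_in_L2[OF finite_measure_\<Omega>])

lemma test_partial_L2: "\<phi> \<in> test_functions \<Omega> \<Longrightarrow> partial_deriv i \<phi> \<in> L2_space \<Omega>"
  by (intro test_L2 test_functions_partial_deriv)

lemma has_weak_partial_lin:
  assumes "f \<in> L2_space \<Omega>" "g \<in> L2_space \<Omega>" "f' \<in> L2_space \<Omega>" "g' \<in> L2_space \<Omega>"
    and "has_weak_partial \<Omega> i f f'" "has_weak_partial \<Omega> i g g'"
  shows "has_weak_partial \<Omega> i (\<lambda>x. f x + c * g x) (\<lambda>x. f' x + c * g' x)"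
  using assms
  by (simp add: has_weak_partial_L2_iff L2.lin L2.lin_mem test_L2 test_partial_L2)

lemma has_weak_partial_cong:
  assumes "has_weak_partial \<Omega> i f h" "f \<in> L2_space \<Omega>" "h \<in> L2_space \<Omega>"
    "AE x in lebesgue_on \<Omega>. f x = g x"
  shows "has_weak_partial \<Omega> i g h"
proof -
  have "L2_inner \<Omega> g (partial_deriv i \<phi>) = - L2_inner \<Omega> h \<phi>" if \<phi>: "\<phi> \<in> test_functions \<Omega>" for \<phi>
    using L2_inner_cong[OF assms(2) test_partial_L2[OF \<phi>, of i] assms(4), of "partial_deriv i \<phi>"] assms(1) \<phi>
    by (simp add: has_weak_partial_L2_iff assms(2,3))
  then show ?thesis by (simp add: has_weak_partial_L2_iff assms(3) L2_cong[OF assms(2,4)])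
qed

text \<open>Weak differentiation is a closed operator in \<open>L\<^sup>2\<close>, because its defining identity is continuous in
both functions. Completeness of the Sobolev spaces rests on this.\<close>

lemma has_weak_partial_limit:
  assumes "\<And>n. s n \<in> L2_space \<Omega>" "\<And>n. g n \<in> L2_space \<Omega>" "u \<in> L2_space \<Omega>" "h \<in> L2_space \<Omega>"
    and hw: "\<And>n. has_weak_partial \<Omega> i (s n) (g n)"
    and "(\<lambda>n. L2_norm \<Omega> (\<lambda>x. s n x - u x)) \<longlonglongrightarrow> 0" "(\<lambda>n. L2_norm \<Omega> (\<lambda>x. g n x - h x)) \<longlonglongrightarrow> 0"
  shows "has_weak_partial \<Omega> i u h"
proof -
  have "L2_inner \<Omega> u (partial_deriv i \<phi>) = - L2_inner \<Omega> h \<phi>" if \<phi>: "\<phi> \<in> test_functions \<Omega>" for \<phi>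
  proof (rule LIMSEQ_unique)
    show "(\<lambda>n. L2_inner \<Omega> (s n) (partial_deriv i \<phi>)) \<longlonglongrightarrow> L2_inner \<Omega> u (partial_deriv i \<phi>)"
      by (rule L2.tendsto_B_left[OF assms(1,3,6) test_partial_L2[OF \<phi>]])
    have "L2_inner \<Omega> (s n) (partial_deriv i \<phi>) = - L2_inner \<Omega> (g n) \<phi>" for n
      using hw[of n] \<phi> by (simp add: has_weak_partial_L2_iff assms(1,2))
    then show "(\<lambda>n. L2_inner \<Omega> (s n) (partial_deriv i \<phi>)) \<longlonglongrightarrow> - L2_inner \<Omega> h \<phi>"
      using tendsto_minus[OF L2.tendsto_B_left[OF assms(2,4,7) test_L2[OF \<phi>]]] by simp
  qed
  then show ?thesis by (simp add: has_weak_partial_L2_iff assms(3,4))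
qed

lemma has_weak_partial_test_function:
  assumes \<phi>: "\<phi> \<in> test_functions \<Omega>"
  shows "has_weak_partial \<Omega> i \<phi> (partial_deriv i \<phi>)"
  using integration_by_parts_test_functions[OF sets_\<Omega> finite_measure_\<Omega> \<phi>]
  by (simp add: has_weak_partial_L2_iff test_L2 test_partial_L2 \<phi>)

section \<open>The spaces H1 and H2\<close>

abbreviation "H1 \<equiv> sobolev_H (Suc 0) \<Omega>"
abbreviation "H2 \<equiv> sobolev_H (Suc (Suc 0)) \<Omega>"
abbreviation "D \<equiv> weak_partial \<Omega>"

lemma H1I:
  assumes "u \<in> L2_space \<Omega>" "\<And>i. g i \<in> L2_space \<Omega>" "\<And>i. has_weak_partial \<Omega> i u (g i)"
  shows "u \<in> H1"
  using assms by (auto simp: sobolev_H.simps)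

lemma H1_L2: "u \<in> H1 \<Longrightarrow> u \<in> L2_space \<Omega>"
  by (simp add: sobolev_H.simps)

lemma H1_has_weak_partial: "u \<in> H1 \<Longrightarrow> has_weak_partial \<Omega> i u (D i u)"
proof -
  assume "u \<in> H1"
  then obtain g where "has_weak_partial \<Omega> i u g" by (auto simp: sobolev_H.simps)
  then show ?thesis by (rule has_weak_partial_weak_partial)
qed

lemma H1_D_L2: "u \<in> H1 \<Longrightarrow> D i u \<in> L2_space \<Omega>"
proof -
  assume "u \<in> H1"
  then obtain g where "g \<in> L2_space \<Omega>" "has_weak_partial \<Omega> i u g" by (auto simp: sobolev_H.simps)
  then show "D i u \<in> L2_space \<Omega>" using L2_cong weak_partial_AE by blast
qed

lemma H1_cong:
  assumes "u \<in> H1" "AE x in lebesgue_on \<Omega>. u x = v x"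
  shows "v \<in> H1"
  by (rule H1I[OF L2_cong[OF H1_L2[OF assms(1)] assms(2)] H1_D_L2[OF assms(1)]])
    (rule has_weak_partial_cong[OF H1_has_weak_partial[OF assms(1)] H1_L2[OF assms(1)] H1_D_L2[OF assms(1)] assms(2)])

lemma D_cong:
  assumes "u \<in> H1" "AE x in lebesgue_on \<Omega>. u x = v x"
  shows "AE x in lebesgue_on \<Omega>. D i u x = D i v x"
  by (rule weak_partial_AE)
    (rule has_weak_partial_cong[OF H1_has_weak_partial[OF assms(1)] H1_L2[OF assms(1)] H1_D_L2[OF assms(1)] assms(2)])

lemma has_weak_partial_D_lin:
  assumes "u \<in> H1" "v \<in> H1"
  shows "has_weak_partial \<Omega> i (\<lambda>x. u x + c * v x) (\<lambda>x. D i u x + c * D i v x)"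
  by (intro has_weak_partial_lin H1_L2 H1_D_L2 H1_has_weak_partial assms)

lemma H1_lin: "u \<in> H1 \<Longrightarrow> v \<in> H1 \<Longrightarrow> (\<lambda>x. u x + c * v x) \<in> H1"
  by (rule H1I[OF L2.lin_mem[OF H1_L2 H1_L2] L2.lin_mem[OF H1_D_L2 H1_D_L2] has_weak_partial_D_lin])

lemma D_lin:
  assumes "u \<in> H1" "v \<in> H1"
  shows "AE x in lebesgue_on \<Omega>. D i u x + c * D i v x = D i (\<lambda>x. u x + c * v x) x"
  by (rule weak_partial_AE[OF has_weak_partial_D_lin[OF assms]])

lemma H1_test: "\<phi> \<in> test_functions \<Omega> \<Longrightarrow> \<phi> \<in> H1"
  by (rule H1I[OF test_L2 test_partial_L2 has_weak_partial_test_function])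

lemma H1_zero: "(\<lambda>x. 0) \<in> H1"
  by (rule H1_test[OF test_functions_zero])

lemma D_test:
  "\<phi> \<in> test_functions \<Omega> \<Longrightarrow> AE x in lebesgue_on \<Omega>. partial_deriv i \<phi> x = D i \<phi> x"
  by (rule weak_partial_AE[OF has_weak_partial_test_function])

lemma H2_H1: "u \<in> H2 \<Longrightarrow> u \<in> H1"
proof -
  assume u: "u \<in> H2"
  then obtain g where "\<And>i. g i \<in> H1" "\<And>i. has_weak_partial \<Omega> i u (g i)"
    unfolding sobolev_H.simps(2)[of "Suc 0"] by (auto simp: Bex_def) metis
  then show "u \<in> H1"
    using u by (intro H1I[of u g]) (auto simp: H1_L2 sobolev_H.simps(2)[of "Suc 0"])
qed

lemma H2_D_H1: "u \<in> H2 \<Longrightarrow> D j u \<in> H1"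
proof -
  assume "u \<in> H2"
  then obtain g where "g \<in> H1" "has_weak_partial \<Omega> j u g"
    by (auto simp: sobolev_H.simps(2)[of "Suc 0"])
  then show "D j u \<in> H1" using H1_cong weak_partial_AE by blast
qed

lemma H2I:
  assumes "u \<in> H1" "\<And>j. D j u \<in> H1"
  shows "u \<in> H2"
proof -
  have "\<exists>g\<in>H1. has_weak_partial \<Omega> j u g" for j
    using H1_has_weak_partial[OF assms(1), of j] assms(2)[of j] by (rule bexI)
  then show ?thesis using H1_L2[OF assms(1)] by (simp add: sobolev_H.simps(2)[of "Suc 0"])
qed

lemma H2_lin:
  assumes "u \<in> H2" "v \<in> H2"
  shows "(\<lambda>x. u x + c * v x) \<in> H2"
  by (intro H2I H1_lin[OF H2_H1 H2_H1] assms
      H1_cong[OF H1_lin[OF H2_D_H1 H2_D_H1] D_lin[OF H2_H1 H2_H1]])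

lemma H2_zero: "(\<lambda>x. 0) \<in> H2"
proof (rule H2I[OF H1_zero])
  fix j :: 'n
  have "partial_deriv j (\<lambda>x. 0) = (\<lambda>x. 0 :: real)"
    by (rule ext) (simp add: partial_deriv_def)
  then show "D j (\<lambda>x. 0) \<in> H1"
    using D_test[OF test_functions_zero, of j] by (intro H1_cong[OF H1_zero]) simp
qed

lemma DD_lin:
  assumes "u \<in> H2" "v \<in> H2"
  shows "AE x in lebesgue_on \<Omega>. D i (D j u) x + c * D i (D j v) x = D i (D j (\<lambda>x. u x + c * v x)) x"
proof -
  have "AE x in lebesgue_on \<Omega>. D i (\<lambda>x. D j u x + c * D j v x) x = D i (D j (\<lambda>x. u x + c * v x)) x"
    by (intro D_cong H1_lin D_lin H2_D_H1 H2_H1 assms)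
  moreover have "AE x in lebesgue_on \<Omega>. D i (D j u) x + c * D i (D j v) x = D i (\<lambda>x. D j u x + c * D j v x) x"
    by (intro D_lin H2_D_H1 assms)
  ultimately show ?thesis by eventually_elim simp
qed

text \<open>Covers the gradient and the Hessian form at once; the operators \<open>E k\<close> need to be linear only almost
everywhere.\<close>

lemma semi_inner_space_sum:
  fixes E :: "'k \<Rightarrow> (real^'n \<Rightarrow> real) \<Rightarrow> real^'n \<Rightarrow> real"
  assumes zero: "(\<lambda>x. 0) \<in> S" and lin: "\<And>u v c. u \<in> S \<Longrightarrow> v \<in> S \<Longrightarrow> (\<lambda>x. u x + c * v x) \<in> S"
    and E: "\<And>k u. u \<in> S \<Longrightarrow> E k u \<in> L2_space \<Omega>"
    and E_lin: "\<And>k u v c. u \<in> S \<Longrightarrow> v \<in> S \<Longrightarrow>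
       AE x in lebesgue_on \<Omega>. E k u x + c * E k v x = E k (\<lambda>x. u x + c * v x) x"
  shows "semi_inner_space S (\<lambda>u v. \<Sum>k\<in>I. L2_inner \<Omega> (E k u) (E k v))"
proof
  fix u v w c assume u: "u \<in> S"
  show "0 \<le> (\<Sum>k\<in>I. L2_inner \<Omega> (E k u) (E k u))"
    by (intro sum_nonneg L2.nonneg E u)
  assume v: "v \<in> S"
  show "(\<Sum>k\<in>I. L2_inner \<Omega> (E k u) (E k v)) = (\<Sum>k\<in>I. L2_inner \<Omega> (E k v) (E k u))"
    by (intro sum.cong refl L2.sym E u v)
  assume w: "w \<in> S"
  have "L2_inner \<Omega> (E k (\<lambda>x. u x + c * v x)) (E k w)
      = L2_inner \<Omega> (E k u) (E k w) + c * L2_inner \<Omega> (E k v) (E k w)" for k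
    using L2_inner_cong[OF L2.lin_mem[OF E[OF u, of k] E[OF v, of k]] E[OF w, of k]
        E_lin[OF u v, where k = k and c = c], of "E k w"]
    by (simp add: L2.lin E u v w)
  then show "(\<Sum>k\<in>I. L2_inner \<Omega> (E k (\<lambda>x. u x + c * v x)) (E k w))
      = (\<Sum>k\<in>I. L2_inner \<Omega> (E k u) (E k w)) + c * (\<Sum>k\<in>I. L2_inner \<Omega> (E k v) (E k w))"
    by (simp add: sum.distrib sum_distrib_left)
qed (rule zero, rule lin)

lemma L2_inner_self_nonneg: "0 \<le> L2_inner \<Omega> f f"
  by (simp add: L2_inner_def)

lemma L2_norm_power2: "(L2_norm \<Omega> f)\<^sup>2 = L2_inner \<Omega> f f"
  by (simp add: L2_norm_def L2_inner_self_nonneg)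

lemma L2_norm_nonneg: "0 \<le> L2_norm \<Omega> f"
  by (simp add: L2_norm_def L2_inner_self_nonneg)

lemma grad_inner_self: "grad_inner \<Omega> u u = (\<Sum>i\<in>UNIV. (L2_norm \<Omega> (D i u))\<^sup>2)"
  by (simp add: grad_inner_def L2_norm_power2)

lemma hess_inner_self: "hess_inner \<Omega> u u = (\<Sum>i\<in>UNIV. \<Sum>j\<in>UNIV. (L2_norm \<Omega> (D i (D j u)))\<^sup>2)"
  by (simp add: hess_inner_def L2_norm_power2)

lemma grad_inner_self_nonneg: "0 \<le> grad_inner \<Omega> u u"
  by (simp add: grad_inner_self sum_nonneg)

lemma hess_inner_self_nonneg: "0 \<le> hess_inner \<Omega> u u"
  by (simp add: hess_inner_self sum_nonneg)

lemma H1_seminorm_power2: "(H1_seminorm \<Omega> u)\<^sup>2 = grad_inner \<Omega> u u"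
  by (simp add: H1_seminorm_def grad_inner_self_nonneg)

lemma H1_norm_power2: "(H1_norm \<Omega> u)\<^sup>2 = (L2_norm \<Omega> u)\<^sup>2 + (H1_seminorm \<Omega> u)\<^sup>2"
  by (simp add: H1_norm_def)

lemma H1_norm_nonneg: "0 \<le> H1_norm \<Omega> u" and H1_seminorm_nonneg: "0 \<le> H1_seminorm \<Omega> u"
  by (simp_all add: H1_norm_def H1_seminorm_def grad_inner_self_nonneg)

lemma L2_norm_le_H1_norm: "L2_norm \<Omega> u \<le> H1_norm \<Omega> u"
  by (rule power2_le_imp_le) (simp_all add: H1_norm_power2 H1_norm_nonneg)

lemma H1_seminorm_le_H1_norm: "H1_seminorm \<Omega> u \<le> H1_norm \<Omega> u"
  by (rule power2_le_imp_le) (simp_all add: H1_norm_power2 H1_norm_nonneg)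

lemma H1_norm_le: "H1_norm \<Omega> u \<le> L2_norm \<Omega> u + H1_seminorm \<Omega> u"
  unfolding H1_norm_def by (rule sqrt_sum_squares_le_sum) (simp_all add: L2_norm_nonneg H1_seminorm_nonneg)

lemma D_le_H1_seminorm: "L2_norm \<Omega> (D i u) \<le> H1_seminorm \<Omega> u"
proof (rule power2_le_imp_le)
  show "(L2_norm \<Omega> (D i u))\<^sup>2 \<le> (H1_seminorm \<Omega> u)\<^sup>2"
    unfolding H1_seminorm_power2 grad_inner_self by (rule member_le_sum) simp_all
qed (rule H1_seminorm_nonneg)

lemma DD_le_H2_seminorm: "L2_norm \<Omega> (D i (D j u)) \<le> H2_seminorm \<Omega> u"
proof (rule power2_le_imp_le)
  have "(L2_norm \<Omega> (D i (D j u)))\<^sup>2 \<le> (\<Sum>j\<in>UNIV. (L2_norm \<Omega> (D i (D j u)))\<^sup>2)"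
    by (rule member_le_sum) simp_all
  also have "\<dots> \<le> (\<Sum>i\<in>UNIV. \<Sum>j\<in>UNIV. (L2_norm \<Omega> (D i (D j u)))\<^sup>2)"
    by (rule member_le_sum[where f = "\<lambda>i. \<Sum>j\<in>UNIV. (L2_norm \<Omega> (D i (D j u)))\<^sup>2"]) (simp_all add: sum_nonneg)
  also have "\<dots> = (H2_seminorm \<Omega> u)\<^sup>2"
    by (simp add: H2_seminorm_def hess_inner_self_nonneg) (simp add: hess_inner_self)
  finally show "(L2_norm \<Omega> (D i (D j u)))\<^sup>2 \<le> (H2_seminorm \<Omega> u)\<^sup>2" .
qed (simp add: H2_seminorm_def hess_inner_self_nonneg)

sublocale H1: semi_inner_space H1 "grad_inner \<Omega>"
  rewrites "semi_inner_space.seminorm (grad_inner \<Omega>) = H1_seminorm \<Omega>"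
proof -
  show *: "semi_inner_space H1 (grad_inner \<Omega>)"
    unfolding grad_inner_def[abs_def]
    by (rule semi_inner_space_sum[where E = D, OF H1_zero H1_lin H1_D_L2 D_lin])
  show "semi_inner_space.seminorm (grad_inner \<Omega>) = H1_seminorm \<Omega>"
    by (rule ext) (simp add: semi_inner_space.seminorm_def[OF *] H1_seminorm_def)
qed

sublocale H2: semi_inner_space H2 "hess_inner \<Omega>"
  rewrites "semi_inner_space.seminorm (hess_inner \<Omega>) = H2_seminorm \<Omega>"
proof -
  have "semi_inner_space H2 (\<lambda>u v. \<Sum>k\<in>UNIV \<times> UNIV.
      L2_inner \<Omega> (D (fst k) (D (snd k) u)) (D (fst k) (D (snd k) v)))"
  proof (rule semi_inner_space_sum[where E = "\<lambda>k u. D (fst k) (D (snd k) u)"])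
    show "D (fst k) (D (snd k) u) \<in> L2_space \<Omega>" if "u \<in> H2" for k u
      by (rule H1_D_L2[OF H2_D_H1[OF that]])
    show "AE x in lebesgue_on \<Omega>. D (fst k) (D (snd k) u) x + c * D (fst k) (D (snd k) v) x
        = D (fst k) (D (snd k) (\<lambda>x. u x + c * v x)) x" if "u \<in> H2" "v \<in> H2" for k u v c
      by (rule DD_lin[OF that])
  qed (rule H2_zero, rule H2_lin)
  moreover have "hess_inner \<Omega> = (\<lambda>u v. \<Sum>k\<in>UNIV \<times> UNIV.
      L2_inner \<Omega> (D (fst k) (D (snd k) u)) (D (fst k) (D (snd k) v)))"
    by (intro ext) (simp only: hess_inner_def sum.cartesian_product case_prod_unfold)
  ultimately show *: "semi_inner_space H2 (hess_inner \<Omega>)" by (simp only:)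
  show "semi_inner_space.seminorm (hess_inner \<Omega>) = H2_seminorm \<Omega>"
    by (rule ext) (simp add: semi_inner_space.seminorm_def[OF *] H2_seminorm_def)
qed

lemma H1_norm_lin:
  assumes "u \<in> H1" "v \<in> H1"
  shows "H1_norm \<Omega> (\<lambda>x. u x + c * v x) \<le> (L2_norm \<Omega> u + H1_seminorm \<Omega> u) + \<bar>c\<bar> * (L2_norm \<Omega> v + H1_seminorm \<Omega> v)"
proof -
  have "H1_norm \<Omega> (\<lambda>x. u x + c * v x) \<le> L2_norm \<Omega> (\<lambda>x. u x + c * v x) + H1_seminorm \<Omega> (\<lambda>x. u x + c * v x)"
    by (rule H1_norm_le)
  also have "\<dots> \<le> (L2_norm \<Omega> u + \<bar>c\<bar> * L2_norm \<Omega> v) + (H1_seminorm \<Omega> u + \<bar>c\<bar> * H1_seminorm \<Omega> v)"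
    by (intro add_mono L2.seminorm_triangle H1.seminorm_triangle H1_L2 assms)
  finally show ?thesis by (simp add: algebra_simps)
qed

lemma D_diff_cong:
  assumes "u \<in> H1" "v \<in> H1"
  shows "L2_norm \<Omega> (D i (\<lambda>x. u x - v x)) = L2_norm \<Omega> (\<lambda>x. D i u x - D i v x)"
proof -
  have "AE x in lebesgue_on \<Omega>. D i u x - D i v x = D i (\<lambda>x. u x - v x) x"
    using D_lin[OF assms, of i "-1"] by simp
  from L2_norm_cong[OF L2.diff_mem[OF H1_D_L2 H1_D_L2] this] show ?thesis using assms by simp
qed

lemma DD_diff_cong:
  assumes "u \<in> H2" "v \<in> H2"
  shows "L2_norm \<Omega> (D i (D j (\<lambda>x. u x - v x))) = L2_norm \<Omega> (\<lambda>x. D i (D j u) x - D i (D j v) x)"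
proof -
  have "AE x in lebesgue_on \<Omega>. D i (D j u) x - D i (D j v) x = D i (D j (\<lambda>x. u x - v x)) x"
    using DD_lin[OF assms, of i j "-1"] by simp
  from L2_norm_cong[OF L2.diff_mem[OF H1_D_L2 H1_D_L2] this] show ?thesis using assms by (simp add: H2_D_H1)
qed

section \<open>The space H10\<close>

lemma H10_iff: "u \<in> H10 \<Omega> \<longleftrightarrow> u \<in> H1 \<and>
    (\<forall>\<epsilon>>0. \<exists>\<phi>\<in>test_functions \<Omega>. H1_norm \<Omega> (\<lambda>x. u x - \<phi> x) < \<epsilon>)"
  by (simp add: H10_def)

lemma H10_H1: "u \<in> H10 \<Omega> \<Longrightarrow> u \<in> H1"
  by (simp add: H10_iff)

lemma H10_L2: "u \<in> H10 \<Omega> \<Longrightarrow> u \<in> L2_space \<Omega>"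
  by (rule H1_L2[OF H10_H1])

lemma H10_approx:
  assumes u: "u \<in> H10 \<Omega>"
  obtains \<phi> where "\<And>n. \<phi> n \<in> test_functions \<Omega>"
    "(\<lambda>n. L2_norm \<Omega> (\<lambda>x. \<phi> n x - u x)) \<longlonglongrightarrow> 0" "(\<lambda>n. H1_seminorm \<Omega> (\<lambda>x. \<phi> n x - u x)) \<longlonglongrightarrow> 0"
proof -
  have "\<exists>\<phi>\<in>test_functions \<Omega>. H1_norm \<Omega> (\<lambda>x. u x - \<phi> x) < 1 / real (Suc n)" for n
    using u by (simp add: H10_iff)
  then obtain \<phi> where \<phi>: "\<And>n. \<phi> n \<in> test_functions \<Omega>"
    "\<And>n. H1_norm \<Omega> (\<lambda>x. u x - \<phi> n x) < 1 / real (Suc n)"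
    by metis
  have lim: "(\<lambda>n. 1 / real (Suc n)) \<longlonglongrightarrow> 0" by (rule LIMSEQ_Suc[OF lim_inverse_n'])
  have L: "L2_norm \<Omega> (\<lambda>x. \<phi> n x - u x) \<le> 1 / real (Suc n)" for n
    using L2.seminorm_diff_commute[OF test_L2[OF \<phi>(1)] H10_L2[OF u]] L2_norm_le_H1_norm \<phi>(2)[of n]
    by (metis less_imp_le order_trans)
  have H: "H1_seminorm \<Omega> (\<lambda>x. \<phi> n x - u x) \<le> 1 / real (Suc n)" for n
    using H1.seminorm_diff_commute[OF H1_test[OF \<phi>(1)] H10_H1[OF u]] H1_seminorm_le_H1_norm \<phi>(2)[of n]
    by (metis less_imp_le order_trans)
  show ?thesis
  proof (rule that[OF \<phi>(1)])
    show "(\<lambda>n. L2_norm \<Omega> (\<lambda>x. \<phi> n x - u x)) \<longlonglongrightarrow> 0"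
      by (rule tendsto_sandwich[OF _ _ tendsto_const lim])
        (intro always_eventually allI L2_norm_nonneg, intro always_eventually allI L)
    show "(\<lambda>n. H1_seminorm \<Omega> (\<lambda>x. \<phi> n x - u x)) \<longlonglongrightarrow> 0"
      by (rule tendsto_sandwich[OF _ _ tendsto_const lim])
        (intro always_eventually allI H1_seminorm_nonneg, intro always_eventually allI H)
  qed
qed

lemma H10_test: "\<phi> \<in> test_functions \<Omega> \<Longrightarrow> \<phi> \<in> H10 \<Omega>"
proof -
  assume \<phi>: "\<phi> \<in> test_functions \<Omega>"
  have "L2_norm \<Omega> (\<lambda>x. 0) = 0" by (simp add: L2_norm_def L2_inner_def)
  moreover have "H1_seminorm \<Omega> (\<lambda>x. 0) = 0"
    using H1.seminorm_scale[OF H1_zero, of 0] by simp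
  ultimately have "H1_norm \<Omega> (\<lambda>x. \<phi> x - \<phi> x) = 0" by (simp add: H1_norm_def)
  then have "\<exists>\<psi>\<in>test_functions \<Omega>. H1_norm \<Omega> (\<lambda>x. \<phi> x - \<psi> x) < e" if "e > 0" for e
    using \<phi> that by (intro bexI[of _ \<phi>]) auto
  then show ?thesis unfolding H10_iff using H1_test[OF \<phi>] by blast
qed

text \<open>A diagonal argument: a test function close to a late member of the sequence is close to the limit.\<close>

lemma H10_limit:
  assumes u: "u \<in> H1" and s: "\<And>n. s n \<in> H10 \<Omega>"
    and lim: "(\<lambda>n. L2_norm \<Omega> (\<lambda>x. s n x - u x)) \<longlonglongrightarrow> 0" "(\<lambda>n. H1_seminorm \<Omega> (\<lambda>x. s n x - u x)) \<longlonglongrightarrow> 0"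
  shows "u \<in> H10 \<Omega>"
  unfolding H10_iff
proof (intro conjI allI impI)
  fix e :: real assume e: "e > 0"
  have "\<forall>\<^sub>F n in sequentially. L2_norm \<Omega> (\<lambda>x. s n x - u x) < e/8 \<and> H1_seminorm \<Omega> (\<lambda>x. s n x - u x) < e/8"
    using e by (intro eventually_conj order_tendstoD(2)[OF lim(1)] order_tendstoD(2)[OF lim(2)]) auto
  then obtain n where n: "L2_norm \<Omega> (\<lambda>x. s n x - u x) < e/8" "H1_seminorm \<Omega> (\<lambda>x. s n x - u x) < e/8"
    unfolding eventually_sequentially by blast
  obtain \<phi> where \<phi>: "\<phi> \<in> test_functions \<Omega>" "H1_norm \<Omega> (\<lambda>x. s n x - \<phi> x) < e/8"
    using s[of n] e unfolding H10_iff by (meson divide_pos_pos zero_less_numeral)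
  have d: "(\<lambda>x. s n x - \<phi> x) \<in> H1" "(\<lambda>x. s n x - u x) \<in> H1"
    using H1.diff_mem[OF H10_H1[OF s] H1_test[OF \<phi>(1)]] H1.diff_mem[OF H10_H1[OF s] u] by blast+
  have "H1_norm \<Omega> (\<lambda>x. u x - \<phi> x) = H1_norm \<Omega> (\<lambda>x. (s n x - \<phi> x) + (-1) * (s n x - u x))"
    by simp
  also have "\<dots> \<le> (L2_norm \<Omega> (\<lambda>x. s n x - \<phi> x) + H1_seminorm \<Omega> (\<lambda>x. s n x - \<phi> x))
      + \<bar>-1\<bar> * (L2_norm \<Omega> (\<lambda>x. s n x - u x) + H1_seminorm \<Omega> (\<lambda>x. s n x - u x))"
    by (rule H1_norm_lin[OF d])
  also have "\<dots> < e"
    using n L2_norm_le_H1_norm[of "\<lambda>x. s n x - \<phi> x"] H1_seminorm_le_H1_norm[of "\<lambda>x. s n x - \<phi> x"] \<phi>(2) e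
    by simp
  finally show "\<exists>\<phi>\<in>test_functions \<Omega>. H1_norm \<Omega> (\<lambda>x. u x - \<phi> x) < e" using \<phi>(1) by (rule bexI)
qed (rule u)

lemma H10_lin:
  assumes u: "u \<in> H10 \<Omega>" and v: "v \<in> H10 \<Omega>"
  shows "(\<lambda>x. u x + c * v x) \<in> H10 \<Omega>"
proof -
  obtain \<phi> where \<phi>: "\<And>n. \<phi> n \<in> test_functions \<Omega>"
    "(\<lambda>n. L2_norm \<Omega> (\<lambda>x. \<phi> n x - u x)) \<longlonglongrightarrow> 0" "(\<lambda>n. H1_seminorm \<Omega> (\<lambda>x. \<phi> n x - u x)) \<longlonglongrightarrow> 0"
    using H10_approx[OF u] by blast
  obtain \<psi> where \<psi>: "\<And>n. \<psi> n \<in> test_functions \<Omega>"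
    "(\<lambda>n. L2_norm \<Omega> (\<lambda>x. \<psi> n x - v x)) \<longlonglongrightarrow> 0" "(\<lambda>n. H1_seminorm \<Omega> (\<lambda>x. \<psi> n x - v x)) \<longlonglongrightarrow> 0"
    using H10_approx[OF v] by blast
  have eq: "(\<lambda>x. (\<phi> n x + c * \<psi> n x) - (u x + c * v x)) = (\<lambda>x. (\<phi> n x - u x) + c * (\<psi> n x - v x))" for n
    by (rule ext) (simp add: algebra_simps)
  have d: "(\<lambda>x. \<phi> n x - u x) \<in> H1" "(\<lambda>x. \<psi> n x - v x) \<in> H1" for n
    by (intro H1.diff_mem H1_test H10_H1 \<phi> \<psi> u v)+
  show ?thesis
  proof (rule H10_limit[where s = "\<lambda>n x. \<phi> n x + c * \<psi> n x"])
    show "(\<lambda>x. u x + c * v x) \<in> H1" by (intro H1_lin H10_H1 u v)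
    show "(\<lambda>x. \<phi> n x + c * \<psi> n x) \<in> H10 \<Omega>" for n by (intro H10_test test_functions_lin \<phi> \<psi>)
    have lim: "(\<lambda>n. L2_norm \<Omega> (\<lambda>x. \<phi> n x - u x) + \<bar>c\<bar> * L2_norm \<Omega> (\<lambda>x. \<psi> n x - v x)) \<longlonglongrightarrow> 0 + \<bar>c\<bar> * 0"
      "(\<lambda>n. H1_seminorm \<Omega> (\<lambda>x. \<phi> n x - u x) + \<bar>c\<bar> * H1_seminorm \<Omega> (\<lambda>x. \<psi> n x - v x)) \<longlonglongrightarrow> 0 + \<bar>c\<bar> * 0"
      by (intro tendsto_intros \<phi> \<psi>)+
    show "(\<lambda>n. L2_norm \<Omega> (\<lambda>x. (\<phi> n x + c * \<psi> n x) - (u x + c * v x))) \<longlonglongrightarrow> 0"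
      unfolding eq
      by (rule tendsto_sandwich[OF _ _ tendsto_const lim(1)[simplified]])
        (intro always_eventually allI L2_norm_nonneg, intro always_eventually allI L2.seminorm_triangle H1_L2 d)
    show "(\<lambda>n. H1_seminorm \<Omega> (\<lambda>x. (\<phi> n x + c * \<psi> n x) - (u x + c * v x))) \<longlonglongrightarrow> 0"
      unfolding eq
      by (rule tendsto_sandwich[OF _ _ tendsto_const lim(2)[simplified]])
        (intro always_eventually allI H1_seminorm_nonneg, intro always_eventually allI H1.seminorm_triangle d)
  qed
qed

lemma H10_zero: "(\<lambda>x. 0) \<in> H10 \<Omega>"
  by (rule H10_test[OF test_functions_zero])

sublocale H10: semi_inner_space "H10 \<Omega>" "grad_inner \<Omega>"
  rewrites "semi_inner_space.seminorm (grad_inner \<Omega>) = H1_seminorm \<Omega>"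
proof -
  show *: "semi_inner_space (H10 \<Omega>) (grad_inner \<Omega>)"
    by unfold_locales
      (auto intro: H10_zero H10_lin H1.sym H1.lin H1.nonneg H10_H1)
  show "semi_inner_space.seminorm (grad_inner \<Omega>) = H1_seminorm \<Omega>"
    by (rule ext) (simp add: semi_inner_space.seminorm_def[OF *] H1_seminorm_def)
qed

text \<open>Both sides are continuous in the \<open>H\<^sup>1\<close> norm, so the inequality passes from test functions to their
closure.\<close>

theorem Poincare_inequality:
  obtains C where "C > 0" "\<And>u. u \<in> H10 \<Omega> \<Longrightarrow> L2_norm \<Omega> u \<le> C * H1_seminorm \<Omega> u"
proof -
  obtain R where R: "R > 0" "\<forall>x\<in>\<Omega>. norm x \<le> R" using bounded_\<Omega> bounded_pos by blast
  then have sub: "\<Omega> \<subseteq> cball 0 R" by auto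
  have "L2_norm \<Omega> u \<le> 2 * R * H1_seminorm \<Omega> u" if u: "u \<in> H10 \<Omega>" for u
  proof -
    have test: "L2_norm \<Omega> \<phi> \<le> 2 * R * H1_seminorm \<Omega> \<phi>" if \<phi>: "\<phi> \<in> test_functions \<Omega>" for \<phi>
    proof -
      fix i :: 'n
      have "L2_norm \<Omega> \<phi> \<le> 2 * R * L2_norm \<Omega> (partial_deriv i \<phi>)"
        by (rule Poincare_test_functions[OF sets_\<Omega> finite_measure_\<Omega> sub _ \<phi>]) (use R in simp)
      also have "L2_norm \<Omega> (partial_deriv i \<phi>) = L2_norm \<Omega> (D i \<phi>)"
        by (rule L2_norm_cong[OF test_partial_L2[OF \<phi>] D_test[OF \<phi>]])
      also have "2 * R * L2_norm \<Omega> (D i \<phi>) \<le> 2 * R * H1_seminorm \<Omega> \<phi>"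
        using R by (intro mult_left_mono D_le_H1_seminorm) simp
      finally show ?thesis .
    qed
    obtain \<phi> where \<phi>: "\<And>n. \<phi> n \<in> test_functions \<Omega>"
      "(\<lambda>n. L2_norm \<Omega> (\<lambda>x. \<phi> n x - u x)) \<longlonglongrightarrow> 0" "(\<lambda>n. H1_seminorm \<Omega> (\<lambda>x. \<phi> n x - u x)) \<longlonglongrightarrow> 0"
      using H10_approx[OF u] by blast
    have "(\<lambda>n. 2 * R * (H1_seminorm \<Omega> u + H1_seminorm \<Omega> (\<lambda>x. \<phi> n x - u x)) + L2_norm \<Omega> (\<lambda>x. \<phi> n x - u x))
        \<longlonglongrightarrow> 2 * R * (H1_seminorm \<Omega> u + 0) + 0"
      by (intro tendsto_intros \<phi>)
    moreover have "L2_norm \<Omega> u \<le> 2 * R * (H1_seminorm \<Omega> u + H1_seminorm \<Omega> (\<lambda>x. \<phi> n x - u x)) + L2_norm \<Omega> (\<lambda>x. \<phi> n x - u x)" for n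
    proof -
      have "L2_norm \<Omega> u \<le> L2_norm \<Omega> (\<phi> n) + L2_norm \<Omega> (\<lambda>x. \<phi> n x - u x)"
        using L2.seminorm_le_add_diff[OF H10_L2[OF u] test_L2[OF \<phi>(1)[of n]]]
          L2.seminorm_diff_commute[OF H10_L2[OF u] test_L2[OF \<phi>(1)[of n]]] by simp
      moreover have "L2_norm \<Omega> (\<phi> n) \<le> 2 * R * H1_seminorm \<Omega> (\<phi> n)" by (rule test[OF \<phi>(1)])
      moreover have "2 * R * H1_seminorm \<Omega> (\<phi> n) \<le> 2 * R * (H1_seminorm \<Omega> u + H1_seminorm \<Omega> (\<lambda>x. \<phi> n x - u x))"
        using R by (intro mult_left_mono H1.seminorm_le_add_diff H1_test \<phi>(1) H10_H1 u) simp
      ultimately show ?thesis by linarith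
    qed
    ultimately show ?thesis by (intro LIMSEQ_le_const[of _ _ "L2_norm \<Omega> u"]) auto
  qed
  then show ?thesis using that[of "2 * R"] R(1) by simp
qed

text \<open>For a test function \<open>w\<close> this is the definition of the weak derivative of \<open>D i v\<close>; both sides are
continuous in \<open>w\<close>. The vanishing trace of \<open>w\<close> thus enters only through density.\<close>

lemma Green_formula:
  assumes w: "w \<in> H10 \<Omega>" and v: "v \<in> H2"
  shows "grad_inner \<Omega> w v = - (\<Sum>i\<in>UNIV. L2_inner \<Omega> w (D i (D i v)))"
proof -
  obtain \<phi> where \<phi>: "\<And>n. \<phi> n \<in> test_functions \<Omega>"
    "(\<lambda>n. L2_norm \<Omega> (\<lambda>x. \<phi> n x - w x)) \<longlonglongrightarrow> 0" "(\<lambda>n. H1_seminorm \<Omega> (\<lambda>x. \<phi> n x - w x)) \<longlonglongrightarrow> 0"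
    using H10_approx[OF w] by blast
  have L: "D i (D i v) \<in> L2_space \<Omega>" "D i v \<in> L2_space \<Omega>" for i
    by (intro H1_D_L2 H2_D_H1 H2_H1 v)+
  have test: "grad_inner \<Omega> (\<phi> n) v = - (\<Sum>i\<in>UNIV. L2_inner \<Omega> (\<phi> n) (D i (D i v)))" for n
  proof -
    have "L2_inner \<Omega> (D i (\<phi> n)) (D i v) = - L2_inner \<Omega> (\<phi> n) (D i (D i v))" for i
    proof -
      have "L2_inner \<Omega> (D i (\<phi> n)) (D i v) = L2_inner \<Omega> (partial_deriv i (\<phi> n)) (D i v)"
        using L2_inner_cong[OF test_partial_L2[OF \<phi>(1)[of n], of i] L(2)[of i] D_test[OF \<phi>(1)[of n], of i], of "D i v"]
        by simp
      also have "\<dots> = L2_inner \<Omega> (D i v) (partial_deriv i (\<phi> n))"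
        by (rule L2.sym[OF test_partial_L2[OF \<phi>(1)] L(2)])
      also have "\<dots> = - L2_inner \<Omega> (D i (D i v)) (\<phi> n)"
        using H1_has_weak_partial[OF H2_D_H1[OF v, of i], of i] \<phi>(1)[of n]
        by (simp add: has_weak_partial_L2_iff L)
      also have "L2_inner \<Omega> (D i (D i v)) (\<phi> n) = L2_inner \<Omega> (\<phi> n) (D i (D i v))"
        by (rule L2.sym[OF L(1) test_L2[OF \<phi>(1)]])
      finally show ?thesis .
    qed
    then show ?thesis by (simp add: grad_inner_def sum_negf)
  qed
  have "(\<lambda>n. grad_inner \<Omega> (\<phi> n) v) \<longlonglongrightarrow> grad_inner \<Omega> w v"
    by (rule H1.tendsto_B_left[OF H1_test[OF \<phi>(1)] H10_H1[OF w] \<phi>(3) H2_H1[OF v]])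
  moreover have "(\<lambda>n. grad_inner \<Omega> (\<phi> n) v) \<longlonglongrightarrow> - (\<Sum>i\<in>UNIV. L2_inner \<Omega> w (D i (D i v)))"
    unfolding test
    by (intro tendsto_minus tendsto_sum L2.tendsto_B_left[OF test_L2[OF \<phi>(1)] H10_L2[OF w] \<phi>(2) L(1)])
  ultimately show ?thesis by (rule LIMSEQ_unique)
qed

lemma V_H10: "v \<in> V_space \<Omega> \<Longrightarrow> v \<in> H10 \<Omega>" and V_H2: "v \<in> V_space \<Omega> \<Longrightarrow> v \<in> H2"
  by (simp_all add: V_space_def numeral_2_eq_2)

lemma V_I: "v \<in> H10 \<Omega> \<Longrightarrow> v \<in> H2 \<Longrightarrow> v \<in> V_space \<Omega>"
  by (simp add: V_space_def numeral_2_eq_2)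

lemma V_lin: "u \<in> V_space \<Omega> \<Longrightarrow> v \<in> V_space \<Omega> \<Longrightarrow> (\<lambda>x. u x + c * v x) \<in> V_space \<Omega>"
  by (rule V_I[OF H10_lin[OF V_H10 V_H10] H2_lin[OF V_H2 V_H2]])

lemma V_zero: "(\<lambda>x. 0) \<in> V_space \<Omega>"
  by (rule V_I[OF H10_zero H2_zero])

text \<open>Green's formula with \<open>w = v\<close> gives \<open>\<parallel>\<nabla>v\<parallel>\<^sup>2 = - (v, \<Delta>v) \<le> \<parallel>v\<parallel> \<parallel>\<Delta>v\<parallel>\<close>; one factor \<open>\<parallel>\<nabla>v\<parallel>\<close> is absorbed by the Poincare
inequality. The constant \<open>n\<close> counts the diagonal second derivatives. This makes the Hessian seminorm
a norm on \<open>V\<close> up to null sets.\<close>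

theorem H1_seminorm_le_H2_seminorm:
  obtains C where "C > 0" "\<And>v. v \<in> V_space \<Omega> \<Longrightarrow> H1_seminorm \<Omega> v \<le> C * H2_seminorm \<Omega> v"
proof -
  obtain P where P: "P > 0" "\<And>u. u \<in> H10 \<Omega> \<Longrightarrow> L2_norm \<Omega> u \<le> P * H1_seminorm \<Omega> u"
    using Poincare_inequality by blast
  define n where "n = real CARD('n)"
  have n: "n > 0" by (simp add: n_def)
  have "H1_seminorm \<Omega> v \<le> (P * n) * H2_seminorm \<Omega> v" if v: "v \<in> V_space \<Omega>" for v
  proof -
    let ?a = "H1_seminorm \<Omega> v" and ?b = "H2_seminorm \<Omega> v"
    have b: "0 \<le> ?b" by (rule H2.seminorm_nonneg[OF V_H2[OF v]])
    have "?a\<^sup>2 = - (\<Sum>i\<in>UNIV. L2_inner \<Omega> v (D i (D i v)))"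
      unfolding H1_seminorm_power2 by (rule Green_formula[OF V_H10[OF v] V_H2[OF v]])
    also have "\<dots> \<le> (\<Sum>i\<in>(UNIV::'n set). (P * ?a) * ?b)"
      unfolding sum_negf[symmetric]
    proof (rule sum_mono)
      fix i :: 'n
      have "- L2_inner \<Omega> v (D i (D i v)) \<le> L2_norm \<Omega> v * L2_norm \<Omega> (D i (D i v))"
        using L2.Cauchy_Schwarz[OF H10_L2[OF V_H10[OF v]] H1_D_L2[OF H2_D_H1[OF V_H2[OF v]]], of i i] by linarith
      also have "\<dots> \<le> (P * ?a) * ?b"
        by (intro mult_mono P(2) V_H10 v DD_le_H2_seminorm mult_nonneg_nonneg less_imp_le[OF P(1)]
            H1_seminorm_nonneg L2_norm_nonneg)
      finally show "- L2_inner \<Omega> v (D i (D i v)) \<le> (P * ?a) * ?b" .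
    qed
    also have "\<dots> = (P * n * ?b) * ?a" by (simp add: n_def)
    finally have *: "?a * ?a \<le> (P * n * ?b) * ?a" by (simp only: power2_eq_square)
    show ?thesis
    proof (cases "?a > 0")
      case True
      with * show ?thesis by (rule mult_right_le_imp_le)
    next
      case False
      moreover have "0 \<le> P * n * ?b" using P(1) n b by simp
      ultimately show ?thesis by linarith
    qed
  qed
  then show ?thesis using that[of "P * n"] P(1) n by simp
qed

section \<open>Completeness of H10 and V\<close>

lemma Cauchy_dominated:
  fixes d :: "nat \<Rightarrow> nat \<Rightarrow> real"
  assumes "\<forall>e>0. \<exists>M. \<forall>m\<ge>M. \<forall>n\<ge>M. d m n < e" "C > 0" "\<And>m n. d' m n \<le> C * d m n"
  shows "\<forall>e>0. \<exists>M. \<forall>m\<ge>M. \<forall>n\<ge>M. d' m n < e"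
proof (intro allI impI)
  fix e :: real assume "e > 0"
  then obtain M where M: "\<And>m n. m \<ge> M \<Longrightarrow> n \<ge> M \<Longrightarrow> d m n < e / C"
    using assms(1)[rule_format, of "e / C"] assms(2) by auto
  have "d' m n < e" if "m \<ge> M" "n \<ge> M" for m n
    using M[OF that] assms(2) assms(3)[of m n] by (simp add: pos_less_divide_eq mult.commute)
  then show "\<exists>M. \<forall>m\<ge>M. \<forall>n\<ge>M. d' m n < e" by blast
qed

lemmas L2_Cauchy_limit = L2.complete_limit[OF L2_complete[OF finite_measure_\<Omega>]]

text \<open>The Poincare inequality makes a Cauchy sequence in the \<open>H\<^sup>1\<close> seminorm Cauchy in \<open>L\<^sup>2\<close>, and its
derivatives converge as well; closedness of the weak derivative identifies their limits.\<close>

theorem H10_complete: "H10.complete"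
  unfolding H10.complete_def
proof (intro allI impI)
  fix s :: "nat \<Rightarrow> real^'n \<Rightarrow> real"
  assume "\<forall>n. s n \<in> H10 \<Omega>"
    and C: "\<forall>e>0. \<exists>M. \<forall>m\<ge>M. \<forall>n\<ge>M. H1_seminorm \<Omega> (\<lambda>x. s m x - s n x) < e"
  then have s: "\<And>n. s n \<in> H10 \<Omega>" by blast
  note sH1 = H10_H1[OF s]
  obtain P where P: "P > 0" "\<And>u. u \<in> H10 \<Omega> \<Longrightarrow> L2_norm \<Omega> u \<le> P * H1_seminorm \<Omega> u"
    using Poincare_inequality by blast
  obtain u where u: "u \<in> L2_space \<Omega>" "(\<lambda>n. L2_norm \<Omega> (\<lambda>x. s n x - u x)) \<longlonglongrightarrow> 0"
  proof (rule L2_Cauchy_limit[of s])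
    show "\<forall>e>0. \<exists>M. \<forall>m\<ge>M. \<forall>n\<ge>M. L2_norm \<Omega> (\<lambda>x. s m x - s n x) < e"
      by (rule Cauchy_dominated[OF C P(1)]) (intro P(2) H10.diff_mem s)
  qed (rule H10_L2[OF s])
  have "\<exists>g. g \<in> L2_space \<Omega> \<and> (\<lambda>n. L2_norm \<Omega> (\<lambda>x. D i (s n) x - g x)) \<longlonglongrightarrow> 0" for i
  proof -
    have "\<forall>e>0. \<exists>M. \<forall>m\<ge>M. \<forall>n\<ge>M. L2_norm \<Omega> (\<lambda>x. D i (s m) x - D i (s n) x) < e"
      by (rule Cauchy_dominated[OF C zero_less_one])
        (simp add: D_diff_cong[OF sH1 sH1, symmetric] D_le_H1_seminorm)
    then show ?thesis by (rule L2_Cauchy_limit[OF H1_D_L2[OF sH1]]) blast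
  qed
  note ex = this
  define g where "g i = (SOME h. h \<in> L2_space \<Omega> \<and> (\<lambda>n. L2_norm \<Omega> (\<lambda>x. D i (s n) x - h x)) \<longlonglongrightarrow> 0)" for i
  have "g i \<in> L2_space \<Omega> \<and> (\<lambda>n. L2_norm \<Omega> (\<lambda>x. D i (s n) x - g i x)) \<longlonglongrightarrow> 0" for i
    unfolding g_def by (rule someI_ex[OF ex])
  note g = this[THEN conjunct1] this[THEN conjunct2]
  have hw: "has_weak_partial \<Omega> i u (g i)" for i
    by (rule has_weak_partial_limit[OF H10_L2[OF s] H1_D_L2[OF sH1] u(1) g(1) H1_has_weak_partial[OF sH1] u(2) g(2)])
  have uH1: "u \<in> H1" by (rule H1I[OF u(1) g(1) hw])
  have norm_eq: "L2_norm \<Omega> (D i (\<lambda>x. s n x - u x)) = L2_norm \<Omega> (\<lambda>x. D i (s n) x - g i x)" for i n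
  proof -
    have "AE x in lebesgue_on \<Omega>. D i (s n) x - g i x = D i (s n) x - D i u x"
      using weak_partial_AE[OF hw[of i]] by eventually_elim simp
    from L2_norm_cong[OF L2.diff_mem[OF H1_D_L2[OF sH1] g(1)] this]
    show ?thesis by (simp add: D_diff_cong[OF sH1 uH1])
  qed
  have "(\<lambda>n. sqrt (\<Sum>i\<in>UNIV. (L2_norm \<Omega> (\<lambda>x. D i (s n) x - g i x))\<^sup>2)) \<longlonglongrightarrow> sqrt (\<Sum>i\<in>(UNIV::'n set). 0\<^sup>2)"
    by (intro tendsto_real_sqrt tendsto_sum tendsto_power g(2))
  then have lim: "(\<lambda>n. H1_seminorm \<Omega> (\<lambda>x. s n x - u x)) \<longlonglongrightarrow> 0"
    by (simp add: H1_seminorm_def grad_inner_self norm_eq)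
  have "u \<in> H10 \<Omega>" by (rule H10_limit[OF uH1 s u(2) lim])
  with lim show "\<exists>u\<in>H10 \<Omega>. (\<lambda>n. H1_seminorm \<Omega> (\<lambda>x. s n x - u x)) \<longlonglongrightarrow> 0" by (rule bexI)
qed

sublocale V: semi_inner_space "V_space \<Omega>" "hess_inner \<Omega>"
  rewrites "semi_inner_space.seminorm (hess_inner \<Omega>) = H2_seminorm \<Omega>"
proof -
  show *: "semi_inner_space (V_space \<Omega>) (hess_inner \<Omega>)"
    by unfold_locales
      (auto intro: V_zero V_lin H2.sym H2.lin H2.nonneg V_H2)
  show "semi_inner_space.seminorm (hess_inner \<Omega>) = H2_seminorm \<Omega>"
    by (rule ext) (simp add: semi_inner_space.seminorm_def[OF *] H2_seminorm_def)
qed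

text \<open>The limit is found in \<open>H10\<close> first; closedness of the weak derivative, now applied to the first
derivatives, shows that it belongs to \<open>H2\<close>.\<close>

theorem V_complete: "V.complete"
  unfolding V.complete_def
proof (intro allI impI)
  fix s :: "nat \<Rightarrow> real^'n \<Rightarrow> real"
  assume "\<forall>n. s n \<in> V_space \<Omega>"
    and C: "\<forall>e>0. \<exists>M. \<forall>m\<ge>M. \<forall>n\<ge>M. H2_seminorm \<Omega> (\<lambda>x. s m x - s n x) < e"
  then have s: "\<And>n. s n \<in> V_space \<Omega>" by blast
  note sH10 = V_H10[OF s] and sH2 = V_H2[OF s]
  obtain Q where Q: "Q > 0" "\<And>v. v \<in> V_space \<Omega> \<Longrightarrow> H1_seminorm \<Omega> v \<le> Q * H2_seminorm \<Omega> v"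
    using H1_seminorm_le_H2_seminorm by blast
  have "\<forall>e>0. \<exists>M. \<forall>m\<ge>M. \<forall>n\<ge>M. H1_seminorm \<Omega> (\<lambda>x. s m x - s n x) < e"
    by (rule Cauchy_dominated[OF C Q(1)]) (intro Q(2) V.diff_mem s)
  then obtain u where u: "u \<in> H10 \<Omega>" "(\<lambda>n. H1_seminorm \<Omega> (\<lambda>x. s n x - u x)) \<longlonglongrightarrow> 0"
    by (rule H10.complete_limit[OF H10_complete sH10])
  have Dlim: "(\<lambda>n. L2_norm \<Omega> (\<lambda>x. D j (s n) x - D j u x)) \<longlonglongrightarrow> 0" for j
    by (rule tendsto_sandwich[OF _ _ tendsto_const u(2)])
      (intro always_eventually allI L2_norm_nonneg,
       simp add: D_diff_cong[OF H10_H1[OF sH10] H10_H1[OF u(1)], symmetric] D_le_H1_seminorm)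
  have "\<exists>g. g \<in> L2_space \<Omega> \<and> (\<lambda>n. L2_norm \<Omega> (\<lambda>x. D i (D j (s n)) x - g x)) \<longlonglongrightarrow> 0" for i j
  proof -
    have "\<forall>e>0. \<exists>M. \<forall>m\<ge>M. \<forall>n\<ge>M. L2_norm \<Omega> (\<lambda>x. D i (D j (s m)) x - D i (D j (s n)) x) < e"
      by (rule Cauchy_dominated[OF C zero_less_one])
        (simp add: DD_diff_cong[OF sH2 sH2, symmetric] DD_le_H2_seminorm)
    then show ?thesis by (rule L2_Cauchy_limit[OF H1_D_L2[OF H2_D_H1[OF sH2]]]) blast
  qed
  note ex = this
  define g where "g i j = (SOME h. h \<in> L2_space \<Omega> \<and>
      (\<lambda>n. L2_norm \<Omega> (\<lambda>x. D i (D j (s n)) x - h x)) \<longlonglongrightarrow> 0)" for i j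
  have "g i j \<in> L2_space \<Omega> \<and> (\<lambda>n. L2_norm \<Omega> (\<lambda>x. D i (D j (s n)) x - g i j x)) \<longlonglongrightarrow> 0" for i j
    unfolding g_def by (rule someI_ex[OF ex])
  note g = this[THEN conjunct1] this[THEN conjunct2]
  have hw: "has_weak_partial \<Omega> i (D j u) (g i j)" for i j
    by (rule has_weak_partial_limit[OF H1_D_L2[OF H10_H1[OF sH10]] H1_D_L2[OF H2_D_H1[OF sH2]]
        H1_D_L2[OF H10_H1[OF u(1)]] g(1) H1_has_weak_partial[OF H2_D_H1[OF sH2]] Dlim g(2)])
  have uH2: "u \<in> H2"
    by (rule H2I[OF H10_H1[OF u(1)] H1I[OF H1_D_L2[OF H10_H1[OF u(1)]] g(1) hw]])
  have norm_eq: "L2_norm \<Omega> (D i (D j (\<lambda>x. s n x - u x))) = L2_norm \<Omega> (\<lambda>x. D i (D j (s n)) x - g i j x)" for i j n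
  proof -
    have "AE x in lebesgue_on \<Omega>. D i (D j (s n)) x - g i j x = D i (D j (s n)) x - D i (D j u) x"
      using weak_partial_AE[OF hw[of i j]] by eventually_elim simp
    from L2_norm_cong[OF L2.diff_mem[OF H1_D_L2[OF H2_D_H1[OF sH2]] g(1)] this]
    show ?thesis by (simp add: DD_diff_cong[OF sH2 uH2])
  qed
  have "(\<lambda>n. sqrt (\<Sum>i\<in>UNIV. \<Sum>j\<in>UNIV. (L2_norm \<Omega> (\<lambda>x. D i (D j (s n)) x - g i j x))\<^sup>2))
      \<longlonglongrightarrow> sqrt (\<Sum>i\<in>(UNIV::'n set). \<Sum>j\<in>(UNIV::'n set). 0\<^sup>2)"
    by (intro tendsto_real_sqrt tendsto_sum tendsto_power g(2))
  then have lim: "(\<lambda>n. H2_seminorm \<Omega> (\<lambda>x. s n x - u x)) \<longlonglongrightarrow> 0"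
    by (simp add: H2_seminorm_def hess_inner_self norm_eq)
  have "u \<in> V_space \<Omega>" by (rule V_I[OF u(1) uH2])
  with lim show "\<exists>u\<in>V_space \<Omega>. (\<lambda>n. H2_seminorm \<Omega> (\<lambda>x. s n x - u x)) \<longlonglongrightarrow> 0" by (rule bexI)
qed

section \<open>Existence, uniqueness and stability of the weak solution\<close>

lemma L2_norm_le_H2_seminorm:
  obtains C where "C > 0" "\<And>v. v \<in> V_space \<Omega> \<Longrightarrow> L2_norm \<Omega> v \<le> C * H2_seminorm \<Omega> v"
proof -
  obtain P where P: "P > 0" "\<And>u. u \<in> H10 \<Omega> \<Longrightarrow> L2_norm \<Omega> u \<le> P * H1_seminorm \<Omega> u"
    using Poincare_inequality by blast
  obtain Q where Q: "Q > 0" "\<And>v. v \<in> V_space \<Omega> \<Longrightarrow> H1_seminorm \<Omega> v \<le> Q * H2_seminorm \<Omega> v"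
    using H1_seminorm_le_H2_seminorm by blast
  have "L2_norm \<Omega> v \<le> (P * Q) * H2_seminorm \<Omega> v" if v: "v \<in> V_space \<Omega>" for v
    using P(2)[OF V_H10[OF v]] mult_left_mono[OF Q(2)[OF v] less_imp_le[OF P(1)]]
    by (simp add: mult.assoc)
  then show ?thesis using that[of "P * Q"] P(1) Q(1) by simp
qed

text \<open>\<open>T\<close> is the solution operator of \<open>- div (\<kappa> \<nabla>z) = f\<close> with homogeneous Dirichlet data. As a function
into \<open>H10\<close> it is determined only up to null sets, hence it need not be linear.\<close>

lemma exists_solution_operator:
  assumes "\<kappa> > 0"
  obtains T where "\<And>f. f \<in> L2_space \<Omega> \<Longrightarrow> T f \<in> H10 \<Omega>"
    "\<And>f u. f \<in> L2_space \<Omega> \<Longrightarrow> u \<in> H10 \<Omega> \<Longrightarrow> \<kappa> * grad_inner \<Omega> (T f) u = L2_inner \<Omega> f u"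
proof -
  obtain P where P: "P > 0" "\<And>u. u \<in> H10 \<Omega> \<Longrightarrow> L2_norm \<Omega> u \<le> P * H1_seminorm \<Omega> u"
    using Poincare_inequality by blast
  have "\<exists>z. z \<in> H10 \<Omega> \<and> (\<forall>u\<in>H10 \<Omega>. \<kappa> * grad_inner \<Omega> z u = L2_inner \<Omega> f u)" if f: "f \<in> L2_space \<Omega>" for f
  proof -
    have lin: "L2_inner \<Omega> f (\<lambda>x. u x + c * v x) / \<kappa> = L2_inner \<Omega> f u / \<kappa> + c * (L2_inner \<Omega> f v / \<kappa>)"
      if "u \<in> H10 \<Omega>" "v \<in> H10 \<Omega>" for u v c
      by (simp add: L2.lin_right[OF H10_L2[OF that(1)] H10_L2[OF that(2)] f] add_divide_distrib)
    have bound: "\<bar>L2_inner \<Omega> f u / \<kappa>\<bar> \<le> (L2_norm \<Omega> f * P / \<kappa>) * H1_seminorm \<Omega> u" if u: "u \<in> H10 \<Omega>" for u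
    proof -
      have "\<bar>L2_inner \<Omega> f u\<bar> \<le> L2_norm \<Omega> f * (P * H1_seminorm \<Omega> u)"
        using L2.Cauchy_Schwarz[OF f H10_L2[OF u]] mult_left_mono[OF P(2)[OF u] L2_norm_nonneg[of f]]
        by linarith
      then show ?thesis using assms by (simp add: abs_divide divide_right_mono mult.assoc)
    qed
    obtain z where z: "z \<in> H10 \<Omega>" "\<And>u. u \<in> H10 \<Omega> \<Longrightarrow> grad_inner \<Omega> z u = L2_inner \<Omega> f u / \<kappa>"
      by (rule H10.Riesz_representation[OF H10_complete lin bound]) (assumption+, rule that)
    then have "\<forall>u\<in>H10 \<Omega>. \<kappa> * grad_inner \<Omega> z u = L2_inner \<Omega> f u" using assms by simp
    then show ?thesis by (intro exI[of _ z] conjI z(1))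
  qed
  note ex = this
  define T where "T f = (SOME z. z \<in> H10 \<Omega> \<and> (\<forall>u\<in>H10 \<Omega>. \<kappa> * grad_inner \<Omega> z u = L2_inner \<Omega> f u))" for f
  have T: "T f \<in> H10 \<Omega> \<and> (\<forall>u\<in>H10 \<Omega>. \<kappa> * grad_inner \<Omega> (T f) u = L2_inner \<Omega> f u)" if "f \<in> L2_space \<Omega>" for f
    unfolding T_def by (rule someI_ex[OF ex[OF that]])
  show ?thesis
    by (rule that[of T]) (use T in blast)+
qed

text \<open>Eliminating \<open>z = T (f - y)\<close> from the first equation leaves the symmetric problem
\<open>(\<nabla>\<^sup>2y, \<nabla>\<^sup>2v) + (T y, v) = (T f, v)\<close> on \<open>V\<close>. The operator \<open>T\<close> is symmetric and nonnegative, so the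
left-hand side is an inner product equivalent to the Hessian form, and the Riesz representation
theorem yields \<open>y\<close>. Symmetry also stands in for linearity of \<open>T\<close>: inside inner products \<open>T\<close> is moved
to the other factor.\<close>

theorem weak_solution_exists:
  assumes \<kappa>: "\<kappa> > 0" and f: "f \<in> L2_space \<Omega>"
  obtains y z where "weak_solution \<Omega> \<kappa> f y z"
proof -
  obtain T where T: "\<And>f. f \<in> L2_space \<Omega> \<Longrightarrow> T f \<in> H10 \<Omega>"
    "\<And>f u. f \<in> L2_space \<Omega> \<Longrightarrow> u \<in> H10 \<Omega> \<Longrightarrow> \<kappa> * grad_inner \<Omega> (T f) u = L2_inner \<Omega> f u"
    by (rule exists_solution_operator[OF \<kappa>]) (rule that)
  obtain P where P: "P > 0" "\<And>u. u \<in> H10 \<Omega> \<Longrightarrow> L2_norm \<Omega> u \<le> P * H1_seminorm \<Omega> u"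
    using Poincare_inequality by blast
  obtain Q where Q: "Q > 0" "\<And>v. v \<in> V_space \<Omega> \<Longrightarrow> L2_norm \<Omega> v \<le> Q * H2_seminorm \<Omega> v"
    using L2_norm_le_H2_seminorm by blast
  have TL2: "T g \<in> L2_space \<Omega>" if "g \<in> L2_space \<Omega>" for g by (rule H10_L2[OF T(1)[OF that]])
  have VL2: "v \<in> L2_space \<Omega>" if "v \<in> V_space \<Omega>" for v by (rule H10_L2[OF V_H10[OF that]])
  have T_sym: "L2_inner \<Omega> (T g) h = L2_inner \<Omega> g (T h)" if g: "g \<in> L2_space \<Omega>" and h: "h \<in> L2_space \<Omega>" for g h
  proof -
    have "L2_inner \<Omega> (T g) h = L2_inner \<Omega> h (T g)" by (rule L2.sym[OF TL2[OF g] h])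
    also have "\<dots> = \<kappa> * grad_inner \<Omega> (T h) (T g)" by (rule T(2)[OF h T(1)[OF g], symmetric])
    also have "\<dots> = \<kappa> * grad_inner \<Omega> (T g) (T h)" by (simp add: H10.sym[OF T(1)[OF g] T(1)[OF h]])
    also have "\<dots> = L2_inner \<Omega> g (T h)" by (rule T(2)[OF g T(1)[OF h]])
    finally show ?thesis .
  qed
  have T_self: "L2_inner \<Omega> (T g) g = \<kappa> * (H1_seminorm \<Omega> (T g))\<^sup>2" if g: "g \<in> L2_space \<Omega>" for g
    unfolding T_sym[OF g g] H1_seminorm_power2 by (rule T(2)[OF g T(1)[OF g], symmetric])
  have T_bound: "L2_inner \<Omega> (T g) g \<le> P\<^sup>2 / \<kappa> * (L2_norm \<Omega> g)\<^sup>2" if g: "g \<in> L2_space \<Omega>" for g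
  proof -
    let ?t = "H1_seminorm \<Omega> (T g)" and ?n = "L2_norm \<Omega> g"
    have "\<kappa> * ?t\<^sup>2 \<le> L2_norm \<Omega> (T g) * ?n"
      using L2.Cauchy_Schwarz[OF TL2[OF g] g] unfolding T_self[OF g] by linarith
    also have "\<dots> \<le> (P * ?t) * ?n" by (rule mult_right_mono[OF P(2)[OF T(1)[OF g]] L2_norm_nonneg])
    finally have 1: "\<kappa> * ?t\<^sup>2 \<le> P * ?n * ?t" by (simp add: mult_ac)
    \<comment> \<open>Completing the square turns \<open>\<kappa> t\<^sup>2 \<le> P n t\<close> into \<open>\<kappa>\<^sup>2 t\<^sup>2 \<le> P\<^sup>2 n\<^sup>2\<close> without dividing by \<open>t\<close>.\<close>
    have "0 \<le> (\<kappa> * ?t - P * ?n)\<^sup>2" by simp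
    then have "2 * \<kappa> * (P * ?n * ?t) \<le> \<kappa> * (\<kappa> * ?t\<^sup>2) + P\<^sup>2 * ?n\<^sup>2"
      by (simp add: power2_eq_square algebra_simps)
    moreover have "\<kappa> * (\<kappa> * ?t\<^sup>2) \<le> \<kappa> * (P * ?n * ?t)" using 1 \<kappa> by (intro mult_left_mono) auto
    ultimately have "\<kappa> * (\<kappa> * ?t\<^sup>2) \<le> P\<^sup>2 * ?n\<^sup>2" by linarith
    then show ?thesis unfolding T_self[OF g] using \<kappa> by (simp add: field_simps)
  qed
  define a where "a u v = hess_inner \<Omega> u v + L2_inner \<Omega> (T u) v" for u v
  have a: "semi_inner_space (V_space \<Omega>) a"
  proof
    fix u v w c assume u: "u \<in> V_space \<Omega>"
    show "0 \<le> a u u"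
      unfolding a_def T_self[OF VL2[OF u]] using V.nonneg[OF u] \<kappa> by simp
    assume v: "v \<in> V_space \<Omega>"
    show "a u v = a v u"
      unfolding a_def T_sym[OF VL2[OF u] VL2[OF v]] V.sym[OF u v]
      using L2.sym[OF VL2[OF u] TL2[OF VL2[OF v]]] by simp
    assume w: "w \<in> V_space \<Omega>"
    show "a (\<lambda>x. u x + c * v x) w = a u w + c * a v w"
      unfolding a_def V.lin[OF u v w] T_sym[OF VL2[OF V.lin_mem[OF u v]] VL2[OF w]]
        T_sym[OF VL2[OF u] VL2[OF w]] T_sym[OF VL2[OF v] VL2[OF w]]
        L2.lin[OF VL2[OF u] VL2[OF v] TL2[OF VL2[OF w]]]
      by (simp add: algebra_simps)
  qed (rule V_zero, rule V_lin)
  interpret a: semi_inner_space "V_space \<Omega>" a by (rule a)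
  have lower: "hess_inner \<Omega> u u \<le> a u u" if u: "u \<in> V_space \<Omega>" for u
    unfolding a_def T_self[OF VL2[OF u]] using \<kappa> by simp
  have upper: "a u u \<le> (1 + P\<^sup>2 / \<kappa> * Q\<^sup>2) * hess_inner \<Omega> u u" if u: "u \<in> V_space \<Omega>" for u
  proof -
    have "(L2_norm \<Omega> u)\<^sup>2 \<le> Q\<^sup>2 * hess_inner \<Omega> u u"
      using power_mono[OF Q(2)[OF u] L2_norm_nonneg, of 2] by (simp only: power_mult_distrib V.seminorm_power2[OF u])
    then have "P\<^sup>2 / \<kappa> * (L2_norm \<Omega> u)\<^sup>2 \<le> P\<^sup>2 / \<kappa> * (Q\<^sup>2 * hess_inner \<Omega> u u)"
      using \<kappa> by (intro mult_left_mono) auto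
    then show ?thesis unfolding a_def using T_bound[OF VL2[OF u]] by (simp add: algebra_simps)
  qed
  have complete: "a.complete"
    by (rule complete_equivalent[OF V.semi_inner_space_axioms a V_complete lower upper])
  have lin: "L2_inner \<Omega> (T f) (\<lambda>x. u x + c * v x) = L2_inner \<Omega> (T f) u + c * L2_inner \<Omega> (T f) v"
    if "u \<in> V_space \<Omega>" "v \<in> V_space \<Omega>" for u v c
    by (rule L2.lin_right[OF VL2[OF that(1)] VL2[OF that(2)] TL2[OF f]])
  have bound: "\<bar>L2_inner \<Omega> (T f) v\<bar> \<le> (L2_norm \<Omega> (T f) * Q) * a.seminorm v" if v: "v \<in> V_space \<Omega>" for v
  proof -
    have "H2_seminorm \<Omega> v \<le> a.seminorm v"
      unfolding H2_seminorm_def a.seminorm_def by (rule real_sqrt_le_mono[OF lower[OF v]])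
    then have "L2_norm \<Omega> v \<le> Q * a.seminorm v"
      using Q(2)[OF v] mult_left_mono[of "H2_seminorm \<Omega> v" "a.seminorm v" Q] Q(1) by linarith
    from mult_left_mono[OF this L2_norm_nonneg] show ?thesis
      using L2.Cauchy_Schwarz[OF TL2[OF f] VL2[OF v]] unfolding mult.assoc by (rule order_trans[rotated])
  qed
  obtain y where y: "y \<in> V_space \<Omega>" "\<And>v. v \<in> V_space \<Omega> \<Longrightarrow> a y v = L2_inner \<Omega> (T f) v"
    by (rule a.Riesz_representation[OF complete lin bound]) (assumption+, rule that)
  let ?g = "\<lambda>x. f x - y x"
  have g: "?g \<in> L2_space \<Omega>" by (rule L2.diff_mem[OF f VL2[OF y(1)]])
  have "weak_solution \<Omega> \<kappa> f y (T ?g)"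
    unfolding weak_solution_def X_space_def U_space_def
  proof (intro conjI ballI SigmaI)
    show "y \<in> V_space \<Omega>" by (rule y(1))
    show "T ?g \<in> H10 \<Omega>" by (rule T(1)[OF g])
    fix p assume "p \<in> V_space \<Omega> \<times> H10 \<Omega>"
    then obtain v u where p: "p = (v, u)" and v: "v \<in> V_space \<Omega>" and u: "u \<in> H10 \<Omega>" by blast
    have "L2_inner \<Omega> (T ?g) v = L2_inner \<Omega> ?g (T v)" by (rule T_sym[OF g VL2[OF v]])
    also have "\<dots> = L2_inner \<Omega> f (T v) - L2_inner \<Omega> y (T v)"
      by (rule L2.diff_left[OF f VL2[OF y(1)] TL2[OF VL2[OF v]]])
    also have "\<dots> = L2_inner \<Omega> (T f) v - L2_inner \<Omega> (T y) v"
      by (simp only: T_sym[OF f VL2[OF v]] T_sym[OF VL2[OF y(1)] VL2[OF v]])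
    also have "\<dots> = hess_inner \<Omega> y v" using y(2)[OF v] by (simp add: a_def)
    finally have 1: "L2_inner \<Omega> (T ?g) v = hess_inner \<Omega> y v" .
    have 2: "\<kappa> * grad_inner \<Omega> (T ?g) u = L2_inner \<Omega> f u - L2_inner \<Omega> y u"
      unfolding T(2)[OF g u] by (rule L2.diff_left[OF f VL2[OF y(1)] H10_L2[OF u]])
    show "case p of (v, u) \<Rightarrow> A_form \<Omega> \<kappa> (y, T ?g) (v, u) = L2_inner \<Omega> f u"
      unfolding p using 1 2 by simp
  qed
  then show ?thesis by (rule that)
qed

lemma weak_solutionD:
  assumes "weak_solution \<Omega> \<kappa> f y z"
  shows "y \<in> V_space \<Omega>" "z \<in> H10 \<Omega>"
    "\<And>v u. v \<in> V_space \<Omega> \<Longrightarrow> u \<in> H10 \<Omega> \<Longrightarrow>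
       hess_inner \<Omega> y v - L2_inner \<Omega> z v + L2_inner \<Omega> y u + \<kappa> * grad_inner \<Omega> z u = L2_inner \<Omega> f u"
  using assms by (auto simp: weak_solution_def X_space_def U_space_def)

lemma weak_solution_diff:
  assumes s: "weak_solution \<Omega> \<kappa> f y z" and s': "weak_solution \<Omega> \<kappa> f y' z'"
  shows "weak_solution \<Omega> \<kappa> (\<lambda>x. 0) (\<lambda>x. y' x - y x) (\<lambda>x. z' x - z x)"
  unfolding weak_solution_def X_space_def U_space_def
proof (intro conjI ballI SigmaI)
  note w = weak_solutionD[OF s] and w' = weak_solutionD[OF s']
  show "(\<lambda>x. y' x - y x) \<in> V_space \<Omega>" by (rule V.diff_mem[OF w'(1) w(1)])
  show "(\<lambda>x. z' x - z x) \<in> H10 \<Omega>" by (rule H10.diff_mem[OF w'(2) w(2)])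
  fix p assume "p \<in> V_space \<Omega> \<times> H10 \<Omega>"
  then obtain v u where p: "p = (v, u)" and v: "v \<in> V_space \<Omega>" and u: "u \<in> H10 \<Omega>" by blast
  have zero: "L2_inner \<Omega> (\<lambda>x. 0) u = 0" by (simp add: L2_inner_def)
  have "A_form \<Omega> \<kappa> (\<lambda>x. y' x - y x, \<lambda>x. z' x - z x) (v, u) = L2_inner \<Omega> f u - L2_inner \<Omega> f u"
    unfolding A_form.simps V.diff_left[OF w'(1) w(1) v] H10.diff_left[OF w'(2) w(2) u]
      L2.diff_left[OF H10_L2[OF w'(2)] H10_L2[OF w(2)] H10_L2[OF V_H10[OF v]]]
      L2.diff_left[OF H10_L2[OF V_H10[OF w'(1)]] H10_L2[OF V_H10[OF w(1)]] H10_L2[OF u]]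
    using w(3)[OF v u] w'(3)[OF v u] by (simp add: algebra_simps)
  then show "case p of (v, u) \<Rightarrow> A_form \<Omega> \<kappa> (\<lambda>x. y' x - y x, \<lambda>x. z' x - z x) (v, u) = L2_inner \<Omega> (\<lambda>x. 0) u"
    unfolding p by (simp add: zero)
qed

text \<open>Testing with the solution itself cancels the coupling terms, which leaves
\<open>\<parallel>\<nabla>\<^sup>2y\<parallel>\<^sup>2 + \<kappa> \<parallel>\<nabla>z\<parallel>\<^sup>2 = (f, z)\<close>; the Poincare inequality bounds the right-hand side by \<open>\<parallel>f\<parallel> P \<parallel>\<nabla>z\<parallel>\<close>.\<close>

theorem weak_solution_stability:
  assumes \<kappa>: "\<kappa> > 0"
  obtains C where "C > 0" "\<And>f y z. f \<in> L2_space \<Omega> \<Longrightarrow> weak_solution \<Omega> \<kappa> f y z \<Longrightarrow>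
    H2_seminorm \<Omega> y + H1_seminorm \<Omega> z \<le> C * L2_norm \<Omega> f"
proof -
  obtain P where P: "P > 0" "\<And>u. u \<in> H10 \<Omega> \<Longrightarrow> L2_norm \<Omega> u \<le> P * H1_seminorm \<Omega> u"
    using Poincare_inequality by blast
  have "H2_seminorm \<Omega> y + H1_seminorm \<Omega> z \<le> (P / sqrt \<kappa> + P / \<kappa>) * L2_norm \<Omega> f"
    if f: "f \<in> L2_space \<Omega>" and s: "weak_solution \<Omega> \<kappa> f y z" for f y z
  proof -
    note w = weak_solutionD[OF s]
    let ?y = "H2_seminorm \<Omega> y" and ?z = "H1_seminorm \<Omega> z" and ?f = "L2_norm \<Omega> f"
    have energy: "?y\<^sup>2 + \<kappa> * ?z\<^sup>2 = L2_inner \<Omega> f z"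
      using w(3)[OF w(1,2)] L2.sym[OF H10_L2[OF V_H10[OF w(1)]] H10_L2[OF w(2)]]
      by (simp add: V.seminorm_power2[OF w(1)] H10.seminorm_power2[OF w(2)])
    have fz: "L2_inner \<Omega> f z \<le> ?f * (P * ?z)"
      using L2.Cauchy_Schwarz[OF f H10_L2[OF w(2)]] mult_left_mono[OF P(2)[OF w(2)] L2_norm_nonneg[of f]]
      by linarith
    have z: "?z \<le> P / \<kappa> * ?f"
    proof (cases "?z > 0")
      case True
      have "(\<kappa> * ?z) * ?z \<le> (P * ?f) * ?z"
      proof -
        have "\<kappa> * ?z\<^sup>2 \<le> ?f * (P * ?z)" using energy fz zero_le_power2[of ?y] by linarith
        then show ?thesis by (simp add: power2_eq_square mult_ac)
      qed
      then have "\<kappa> * ?z \<le> P * ?f" using True by (rule mult_right_le_imp_le)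
      then show ?thesis using \<kappa> by (simp add: field_simps)
    next
      case False
      moreover have "0 \<le> P / \<kappa> * ?f" using P(1) \<kappa> L2_norm_nonneg[of f] by simp
      ultimately show ?thesis by linarith
    qed
    have y: "?y \<le> P / sqrt \<kappa> * ?f"
    proof (rule power2_le_imp_le)
      have "0 \<le> \<kappa> * ?z\<^sup>2" using \<kappa> by simp
      then have "?y\<^sup>2 \<le> ?f * P * ?z" using energy fz by (simp add: mult.assoc)
      also have "\<dots> \<le> ?f * P * (P / \<kappa> * ?f)"
        using P(1) L2_norm_nonneg[of f] by (intro mult_left_mono z) simp
      also have "\<dots> = (P / sqrt \<kappa> * ?f)\<^sup>2"
        using \<kappa> by (simp add: power_mult_distrib power_divide power2_eq_square)
      finally show "?y\<^sup>2 \<le> (P / sqrt \<kappa> * ?f)\<^sup>2" .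
      show "0 \<le> P / sqrt \<kappa> * ?f" using P(1) \<kappa> L2_norm_nonneg[of f] by simp
    qed
    from y z show ?thesis by (simp add: distrib_right)
  qed
  moreover have "P / sqrt \<kappa> + P / \<kappa> > 0" using P(1) \<kappa> by (simp add: add_pos_pos)
  ultimately show ?thesis by (rule that[rotated])
qed

theorem weak_solution_unique:
  assumes \<kappa>: "\<kappa> > 0" and s: "weak_solution \<Omega> \<kappa> f y z" and s': "weak_solution \<Omega> \<kappa> f y' z'"
  shows "(AE x in lebesgue_on \<Omega>. y' x = y x) \<and> (AE x in lebesgue_on \<Omega>. z' x = z x)"
proof -
  let ?y = "\<lambda>x. y' x - y x" and ?z = "\<lambda>x. z' x - z x"
  have d: "weak_solution \<Omega> \<kappa> (\<lambda>x. 0) ?y ?z" by (rule weak_solution_diff[OF s s'])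
  note w = weak_solutionD[OF d]
  obtain P where P: "P > 0" "\<And>u. u \<in> H10 \<Omega> \<Longrightarrow> L2_norm \<Omega> u \<le> P * H1_seminorm \<Omega> u"
    using Poincare_inequality by blast
  obtain Q where Q: "Q > 0" "\<And>v. v \<in> V_space \<Omega> \<Longrightarrow> L2_norm \<Omega> v \<le> Q * H2_seminorm \<Omega> v"
    using L2_norm_le_H2_seminorm by blast
  obtain C where "C > 0" and C: "\<And>f y z. f \<in> L2_space \<Omega> \<Longrightarrow> weak_solution \<Omega> \<kappa> f y z \<Longrightarrow>
    H2_seminorm \<Omega> y + H1_seminorm \<Omega> z \<le> C * L2_norm \<Omega> f"
    by (rule weak_solution_stability[OF \<kappa>]) (rule that)
  have "L2_norm \<Omega> (\<lambda>x. 0) = 0" by (simp add: L2_norm_def L2_inner_def)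
  then have "H2_seminorm \<Omega> ?y = 0" "H1_seminorm \<Omega> ?z = 0"
    using C[OF L2.zero_mem d] V.seminorm_nonneg[OF w(1)] H10.seminorm_nonneg[OF w(2)] by simp_all
  then have "L2_norm \<Omega> ?y = 0" "L2_norm \<Omega> ?z = 0"
    using Q(2)[OF w(1)] P(2)[OF w(2)] L2_norm_nonneg[of ?y] L2_norm_nonneg[of ?z] by simp_all
  then show ?thesis
    using L2_norm_zero_imp_AE[OF H10_L2[OF V_H10[OF w(1)]]] L2_norm_zero_imp_AE[OF H10_L2[OF w(2)]]
    by simp
qed

end

section \<open>The mixed formulation is well posed\<close>

theorem mainTheorem4:
  fixes \<Omega> :: "(real^'n) set" and \<kappa> :: real
  assumes "CARD('n) = 2 \<or> CARD('n) = 3"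
    and "open \<Omega>" and "bounded \<Omega>" and "convex \<Omega>" and "\<Omega> \<noteq> {}"
    and "polyhedron (closure \<Omega>)"
    and "\<kappa> > 0"
  shows "(\<forall>f\<in>L2_space \<Omega>. \<exists>y z. weak_solution \<Omega> \<kappa> f y z \<and>
            (\<forall>y' z'. weak_solution \<Omega> \<kappa> f y' z' \<longrightarrow>
               (AE x in lebesgue_on \<Omega>. y' x = y x) \<and> (AE x in lebesgue_on \<Omega>. z' x = z x)))
       \<and> (\<exists>C>0. \<forall>f\<in>L2_space \<Omega>. \<forall>y z. weak_solution \<Omega> \<kappa> f y z \<longrightarrow>
            V_norm \<Omega> y + U_norm \<Omega> z \<le> C * L2_norm \<Omega> f)"
proof -
  interpret bounded_open_set \<Omega> by unfold_locales fact+
  have "\<exists>y z. weak_solution \<Omega> \<kappa> f y z \<and> (\<forall>y' z'. weak_solution \<Omega> \<kappa> f y' z' \<longrightarrow>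
      (AE x in lebesgue_on \<Omega>. y' x = y x) \<and> (AE x in lebesgue_on \<Omega>. z' x = z x))"
    if f: "f \<in> L2_space \<Omega>" for f
  proof -
    obtain y z where s: "weak_solution \<Omega> \<kappa> f y z"
      by (rule weak_solution_exists[OF \<open>\<kappa> > 0\<close> f])
    show ?thesis
      by (intro exI[of _ y] exI[of _ z] conjI[OF s] allI impI weak_solution_unique[OF \<open>\<kappa> > 0\<close> s])
  qed
  moreover obtain C where C: "C > 0" "\<And>f y z. f \<in> L2_space \<Omega> \<Longrightarrow> weak_solution \<Omega> \<kappa> f y z \<Longrightarrow>
      H2_seminorm \<Omega> y + H1_seminorm \<Omega> z \<le> C * L2_norm \<Omega> f"
    by (rule weak_solution_stability[OF \<open>\<kappa> > 0\<close>]) (rule that)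
  ultimately show ?thesis
    unfolding V_norm_def U_norm_def by (intro conjI ballI exI[of _ C] allI impI C(1)) (simp_all add: C(2))
qed

end
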